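(* Let $x$, $y$, $z$ be even non-negative integers, let $k\ge 1$ and let $a_1,\dotsc,a_k$ be non-negative integers. Put $a_{k+i}:=a_{k-i+1}$ for $i=1,\dotsc,k$, so that $(a_1,\dotsc,a_{2k})=(a_1,\dotsc,a_k,a_k,\dotsc,a_1)$, and let $a:=a_1+\cdots+a_k$. Then \[ \frac{\mathrm{M}_{\odot}(FC_{x,y,z}(a_1,\dotsc,a_k,a_k,\dotsc,a_1))}{\mathrm{M}_{\odot}(FC_{x,y,z}(a,a))} =\sqrt{\frac{\mathrm{M}(FC_{x,y,z}(a_1,\dotsc,a_k,a_k,\dotsc,a_1))}{\mathrm{M}(FC_{x,y,z}(a,a))}} \] and both sides are equal to \[ s(a_1,\dotsc,a_k,a_k,\dotsc,a_1)\, \frac{\mathrm{h}(\frac{x+z}{2}+a)}{\mathrm{h}(\frac{x+y}{2}+a)} \prod_{i\ge 0,\ 1\le 2i+1\le 2k}\frac{\mathrm{h}(\frac{x+y}{2}+a_1+\cdots+a_{2i+1})}{\mathrm{h}(\frac{x+z}{2}+a_1+\cdots+a_{2i+1})} \prod_{i\ge 1,\ 1<2i<2k}\frac{\mathrm{h}(\frac{x+z}{2}+a_1+\cdots+a_{2i})}{\mathrm{h}(\frac{x+y}{2}+a_1+\cdots+a_{2i})}. \]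
   Context: We work on the triangular lattice with one family of lattice lines horizontal; its faces are unit up-pointing and down-pointing triangles. A lozenge is the union of two unit triangles sharing an edge; a lozenge tiling of a lattice region $R$ is a covering of $R$ by lozenges without gaps or overlaps. $\mathrm{M}(R)$ denotes the number of lozenge tilings of $R$; if $R$ is centrally symmetric, $\mathrm{M}_\odot(R)$ denotes the number of lozenge tilings of $R$ invariant under the rotation by $180^\circ$ about the center of $R$. Fern: for non-negative integers $b_1,\dotsc,b_m$, the fern $F(b_1,\dotsc,b_m)$ is a string of $m$ lattice triangles lined up along a horizontal lattice line, consecutive ones touching at a vertex, of side lengths $b_1,\dotsc,b_m$ from left to right, alternately pointing up and down with the leftmost (the one of size $b_1$) pointing up (a triangle of size $0$ is a single point). Its base point is its leftmost point. Fern-cored hexagon: let $x,y,z$ be even non-negative integers and $a=a_1+\cdots+a_k$. Let $H$ be the lattice hexagon with side lengths $x+a$, $y+a$, $z+a$, $x+a$, $y+a$, $z+a$ listed clockwise starting from the (horizontal) top side. The auxiliary hexagon $\bar H$ is the hexagon of side lengths $x,y,z,x,y,z$ (clockwise from top) that fits in the western corner of $H$ (sharing that corner and the directions of the two sides meeting there); its center is a lattice point. For a list $(b_1,\dots,b_m)$ with (sum of odd-indexed entries) $=$ (sum of even-indexed entries) $=a$, the region $FC_{x,y,z}(b_1,\dotsc,b_m)$ is obtained from $H$ by removing the fern $F(b_1,\dotsc,b_m)$ translated so that its base point is the center of $\bar H$ (equivalently, the fern lies on the horizontal lattice line through the center of $H$ and is centered at the center of $H$). In particular $FC_{x,y,z}(a,a)$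 has a removed two-lobed fern $F(a,a)$, and $FC_{x,y,z}(a_1,\dotsc,a_k,a_k,\dotsc,a_1)$ has removed fern $F(a_1,\dotsc,a_k,a_k,\dotsc,a_1)$; both regions are centrally symmetric about the center of $H$. Hyperfactorial: $\mathrm{h}(n):=0!\,1!\cdots(n-1)!$ (with $\mathrm{h}(0)=1$). The function $s$: for non-negative integers $b_1,\dotsc,b_{2l}$ set $s(b_1,\dotsc,b_{2l}):=s(b_1,\dotsc,b_{2l-1})$, and \[ s(b_1,\dotsc,b_{2l-1}):=\frac{\prod_{1\le i\le j\le 2l-1,\ j-i+1\text{ odd}}\mathrm{h}(b_i+b_{i+1}+\cdots+b_j)}{\prod_{1\le i\le j\le 2l-1,\ j-i+1\text{ even}}\mathrm{h}(b_i+b_{i+1}+\cdots+b_j)}\cdot\frac{1}{\mathrm{h}(b_1+b_3+\cdots+b_{2l-1})}. \] (This equals the number of lozenge tilings of a semihexagon whose base has alternately removed/kept segments of lengths $b_1,b_2,\dots$ of up-pointing unit triangles.) *)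

theory Defs
  imports Complex_Main
begin

text \<open>
  The lattice point \<open>(i, j)\<close> stands for \<open>i e\<^sub>1 + j e\<^sub>2\<close>, where \<open>e\<^sub>1 = (1, 0)\<close> points east and
  \<open>e\<^sub>2 = (1/2, sqrt 3 / 2)\<close> points north-east; south-east is \<open>e\<^sub>1 - e\<^sub>2\<close>.  Horizontal lattice lines
  are the lines of constant \<open>j\<close>.
\<close>

type_synonym point = "int \<times> int"

datatype unit_triangle = Up int int | Down int int

fun vertices :: "unit_triangle \<Rightarrow> point set" where
  "vertices (Up i j) = {(i, j), (i + 1, j), (i, j + 1)}"
| "vertices (Down i j) = {(i + 1, j), (i, j + 1), (i + 1, j + 1)}"

text \<open>
  A lattice region is a set of unit triangles.  The region cut out by a convex lattice polygon
  consists of the unit triangles all of whose vertices lie in the polygon.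
\<close>

type_synonym region = "unit_triangle set"

definition region_of :: "point set \<Rightarrow> region" where
  "region_of P = {t. vertices t \<subseteq> P}"

definition is_lozenge :: "unit_triangle set \<Rightarrow> bool" where
  "is_lozenge L \<longleftrightarrow> (\<exists>s t. L = {s, t} \<and> s \<noteq> t \<and> card (vertices s \<inter> vertices t) = 2)"

definition is_tiling :: "region \<Rightarrow> unit_triangle set set \<Rightarrow> bool" where
  "is_tiling R T \<longleftrightarrow> (\<forall>L\<in>T. is_lozenge L) \<and> pairwise disjnt T \<and> \<Union>T = R"

definition M :: "region \<Rightarrow> nat" where
  "M R = card {T. is_tiling R T}"

text \<open>
  The rotation by 180 degrees about a centre \<open>c\<close> is \<open>v \<mapsto> 2 c - v\<close>.  The first argument \<open>d\<close>
  below is the doubled centre \<open>2 c\<close>.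
\<close>

fun rotate_point :: "point \<Rightarrow> point \<Rightarrow> point" where
  "rotate_point (d1, d2) (i, j) = (d1 - i, d2 - j)"

fun rotate_triangle :: "point \<Rightarrow> unit_triangle \<Rightarrow> unit_triangle" where
  "rotate_triangle (d1, d2) (Up i j) = Down (d1 - i - 1) (d2 - j - 1)"
| "rotate_triangle (d1, d2) (Down i j) = Up (d1 - i - 1) (d2 - j - 1)"

lemma vertices_rotate_triangle:
  "vertices (rotate_triangle d t) = rotate_point d ` vertices t"
  by (cases d; cases t) auto

definition M_odot :: "point \<Rightarrow> region \<Rightarrow> nat" where
  "M_odot d R = card {T. is_tiling R T \<and> (`) (rotate_triangle d) ` T = T}"

text \<open>
  The hexagon with side lengths \<open>X, Y, Z, X, Y, Z\<close> clockwise from the top side and western corner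
  \<open>(0, 0)\<close>; its remaining corners are, clockwise, \<open>(0, Z)\<close>, \<open>(X, Z)\<close>, \<open>(X + Y, Z - Y)\<close>,
  \<open>(X + Y, - Y)\<close> and \<open>(Y, - Y)\<close>, so its doubled centre is \<open>(X + Y, Z - Y)\<close>.
\<close>

definition hexagon :: "nat \<Rightarrow> nat \<Rightarrow> nat \<Rightarrow> region" where
  "hexagon X Y Z = region_of {(i, j). 0 \<le> i \<and> i \<le> int X + int Y
      \<and> - int Y \<le> j \<and> j \<le> int Z \<and> 0 \<le> i + j \<and> i + j \<le> int X + int Z}"

definition hexagon_centre2 :: "nat \<Rightarrow> nat \<Rightarrow> nat \<Rightarrow> point" where
  "hexagon_centre2 X Y Z = (int X + int Y, int Z - int Y)"

text \<open>
  The lattice triangles of side \<open>b\<close> whose horizontal side has left endpoint \<open>(p, q)\<close>: the third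
  corner is \<open>(p, q + b)\<close> for the up-pointing and \<open>(p + b, q - b)\<close> for the down-pointing one.
\<close>

definition up_triangle :: "point \<Rightarrow> nat \<Rightarrow> region" where
  "up_triangle = (\<lambda>(p, q) b. region_of {(i, j). p \<le> i \<and> q \<le> j \<and> i + j \<le> p + q + int b})"

definition down_triangle :: "point \<Rightarrow> nat \<Rightarrow> region" where
  "down_triangle = (\<lambda>(p, q) b. region_of {(i, j). i \<le> p + int b \<and> j \<le> q \<and> p + q \<le> i + j})"

text \<open>
  Lists are indexed from 0, so the odd-indexed entries \<open>b\<^sub>1, b\<^sub>3, \<dots>\<close> sit at the even positions.
\<close>

definition fern :: "point \<Rightarrow> nat list \<Rightarrow> region" where
  "fern = (\<lambda>(p, q) bs. \<Union>i<length bs.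
      (let v = (p + int (sum_list (take i bs)), q)
       in if even i then up_triangle v (bs ! i) else down_triangle v (bs ! i)))"

definition odd_sum :: "nat list \<Rightarrow> nat" where
  "odd_sum bs = (\<Sum>i | i < length bs \<and> even i. bs ! i)"

text \<open>
  Fern-cored hexagons, intended for even \<open>x, y, z\<close> and lists whose odd-indexed and even-indexed
  entries have the same sum.  The base point of the fern is the centre of the hexagon with sides
  \<open>x, y, z, x, y, z\<close> in the western corner.
\<close>

definition FC :: "nat \<Rightarrow> nat \<Rightarrow> nat \<Rightarrow> nat list \<Rightarrow> region" where
  "FC x y z bs = (let a = odd_sum bs in
      hexagon (x + a) (y + a) (z + a)
        - fern ((int x + int y) div 2, (int z - int y) div 2) bs)"

definition FC_centre2 :: "nat \<Rightarrow> nat \<Rightarrow> nat \<Rightarrow> nat list \<Rightarrow> point" where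
  "FC_centre2 x y z bs = (let a = odd_sum bs in hexagon_centre2 (x + a) (y + a) (z + a))"

definition h :: "nat \<Rightarrow> nat" where
  "h n = (\<Prod>i<n. fact i)"

definition s_odd :: "nat list \<Rightarrow> real" where
  "s_odd bs =
     (\<Prod>(i, j) | i \<le> j \<and> j < length bs \<and> odd (j - i + 1). real (h (\<Sum>t=i..j. bs ! t)))
   / (\<Prod>(i, j) | i \<le> j \<and> j < length bs \<and> even (j - i + 1). real (h (\<Sum>t=i..j. bs ! t)))
   * (1 / real (h (odd_sum bs)))"

definition s :: "nat list \<Rightarrow> real" where
  "s bs = (if even (length bs) then s_odd (butlast bs) else s_odd bs)"

end

theory Submission
  imports Defs "HOL-Library.Disjoint_Sets" "Jordan_Normal_Form.Determinant"
begin

text \<open>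
  Cut the hexagon along the horizontal line through its centre.  A tiling is determined by the set
  \<open>S\<close> of positions of the lozenges crossing this line and by tilings of the two halves.  The upper
  half is a trapezoid with dents along its base at \<open>S\<close>, at the up-pointing lobes \<open>U\<close> of the fern and
  at one corner \<open>C\<close>: removing a triangle standing on the base amounts to removing the unit triangles
  in its bottom row, since the rest of it is then filled by forced lozenges.  Such a trapezoid with
  \<open>n\<close> dents has \<open>\<Delta> / h n\<close> tilings, where \<open>\<Delta>\<close> is the product of the distances of the dents: when
  its bottom row is cut off, the dents of the remaining trapezoid interlace with the given ones, and
  this recursion is solved by a determinant of binomial coefficients.

  The lower half is the upper half turned around, with \<open>S\<close> replaced by its mirror image.  As the
  up-pointing lobes and their mirror images fill the whole fern, the factors in which \<open>S\<close> interacts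
  with \<open>U\<close> multiply up to a quantity that does not depend on how the fern is divided into lobes.
  Hence the number of all tilings is \<open>\<Delta>(U \<union> C)\<^sup>2\<close> times, and the number of centrally symmetric
  tilings is \<open>\<Delta>(U \<union> C)\<close> times, a constant independent of the lobes.
\<close>

section \<open>Determinants\<close>

lemma det_cumulative_rows:
  fixes f :: "nat \<Rightarrow> nat \<Rightarrow> 'a :: comm_ring_1"
  shows "det (mat n n (\<lambda>(i, j). \<Sum>k\<le>i. f k j)) = det (mat n n (\<lambda>(i, j). f i j))"
proof -
  define L :: "'a mat" where "L = mat n n (\<lambda>(i, k). of_bool (k \<le> i))"
  let ?A = "mat n n (\<lambda>(i, j). f i j)"
  have carrier: "L \<in> carrier_mat n n" "?A \<in> carrier_mat n n" by (simp_all add: L_def)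
  have "mat n n (\<lambda>(i, j). \<Sum>k\<le>i. f k j) = L * ?A"
  proof (rule eq_matI)
    fix i j assume "i < dim_row (L * ?A)" "j < dim_col (L * ?A)"
    then have ij: "i < n" "j < n" by (simp_all add: L_def)
    have "(\<Sum>k\<le>i. f k j) = (\<Sum>k = 0..<n. of_bool (k \<le> i) * f k j)"
      using ij by (intro sum.mono_neutral_cong_left) auto
    then show "mat n n (\<lambda>(i, j). \<Sum>k\<le>i. f k j) $$ (i, j) = (L * ?A) $$ (i, j)"
      using ij by (simp add: L_def scalar_prod_def)
  qed (simp_all add: L_def)
  moreover have "det L = 1"
    by (subst det_lower_triangular[OF _ carrier(1)]) (simp_all add: L_def prod_list_diag_prod)
  ultimately show ?thesis by (simp add: det_mult[OF carrier])
qed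

lemma det_pivot_column:
  fixes f :: "nat \<Rightarrow> nat \<Rightarrow> 'a :: comm_ring_1"
  assumes "\<And>i. i < n \<Longrightarrow> f (Suc i) 0 = 0"
  shows "det (mat (Suc n) (Suc n) (\<lambda>(i, j). f i j))
    = f 0 0 * det (mat n n (\<lambda>(i, j). f (Suc i) (Suc j)))"
proof -
  let ?A = "mat (Suc n) (Suc n) (\<lambda>(i, j). f i j)"
  have "det ?A = (\<Sum>i<Suc n. ?A $$ (i, 0) * cofactor ?A i 0)"
    by (rule laplace_expansion_column) auto
  also have "\<dots> = f 0 0 * cofactor ?A 0 0"
    using assms by (subst sum.lessThan_Suc_shift) simp
  also have "cofactor ?A 0 0 = det (mat n n (\<lambda>(i, j). f (Suc i) (Suc j)))"
    by (auto simp: cofactor_def mat_delete_def intro!: arg_cong[where f = det])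
  finally show ?thesis .
qed

text \<open>Any polynomials \<open>p\<^sub>j\<close> of degree at most \<open>j\<close> arise from the monomials by an upper triangular
  change of basis.\<close>

lemma det_poly_eval:
  fixes p :: "nat \<Rightarrow> 'a :: comm_ring_1 poly"
  assumes "\<And>j. degree (p j) \<le> j"
  shows "det (mat n n (\<lambda>(i, j). poly (p j) (c i)))
     = det (mat n n (\<lambda>(i, j). c i ^ j)) * (\<Prod>j<n. coeff (p j) j)"
proof -
  define V where "V = mat n n (\<lambda>(i, j). c i ^ j)"
  define C where "C = mat n n (\<lambda>(k, j). coeff (p j) k)"
  have carrier: "V \<in> carrier_mat n n" "C \<in> carrier_mat n n" by (simp_all add: V_def C_def)
  have "mat n n (\<lambda>(i, j). poly (p j) (c i)) = V * C"
  proof (rule eq_matI)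
    fix i j assume "i < dim_row (V * C)" "j < dim_col (V * C)"
    then have ij: "i < n" "j < n" by (simp_all add: V_def C_def)
    have "poly (p j) (c i) = (\<Sum>k\<le>degree (p j). coeff (p j) k * c i ^ k)"
      by (rule poly_altdef)
    also have "\<dots> = (\<Sum>k = 0..<n. c i ^ k * coeff (p j) k)"
      using assms[of j] ij
      by (intro sum.mono_neutral_cong_left) (auto simp: coeff_eq_0 mult.commute)
    finally show "mat n n (\<lambda>(i, j). poly (p j) (c i)) $$ (i, j) = (V * C) $$ (i, j)"
      using ij by (simp add: V_def C_def scalar_prod_def)
  qed (simp_all add: V_def C_def)
  moreover have "det C = (\<Prod>j<n. coeff (p j) j)"
    using le_less_trans[OF assms]
    by (subst det_upper_triangular[OF _ carrier(2)])
      (auto simp: C_def coeff_eq_0 prod_list_diag_prod lessThan_atLeast0)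
  ultimately show ?thesis using det_mult[OF carrier] by (simp add: V_def)
qed

lemma degree_prod_linear: "degree (\<Prod>l<j. [:- c l, 1:]) = j"
  for c :: "nat \<Rightarrow> 'a :: idom"
  by (simp add: degree_prod_eq_sum_degree)

lemma coeff_prod_linear: "coeff (\<Prod>l<j. [:- c l, 1:]) j = 1"
  for c :: "nat \<Rightarrow> 'a :: idom"
  using lead_coeff_prod[of "\<lambda>l. [:- c l, 1:]" "{..<j}"] by (simp add: degree_prod_linear)

lemma det_vandermonde:
  fixes c :: "nat \<Rightarrow> 'a :: idom"
  shows "det (mat n n (\<lambda>(i, j). c i ^ j)) = (\<Prod>i<n. \<Prod>l<i. c i - c l)"
proof -
  define p where "p j = (\<Prod>l<j. [:- c l, 1:])" for j
  let ?A = "mat n n (\<lambda>(i, j). poly (p j) (c i))"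
  have "det ?A = det (mat n n (\<lambda>(i, j). c i ^ j)) * (\<Prod>j<n. coeff (p j) j)"
    by (rule det_poly_eval) (simp add: p_def degree_prod_linear)
  moreover have "det ?A = (\<Prod>i<n. poly (p i) (c i))"
    by (subst det_lower_triangular[of n])
      (auto simp: p_def poly_prod prod_list_diag_prod lessThan_atLeast0)
  ultimately show ?thesis by (simp add: p_def coeff_prod_linear poly_prod)
qed

definition det_of_rows :: "(nat \<Rightarrow> 'a :: comm_ring_1) list \<Rightarrow> 'a" where
  "det_of_rows rs = det (mat (length rs) (length rs) (\<lambda>(i, j). (rs ! i) j))"

lemma det_of_rows_sum:
  "det_of_rows (pre @ (\<lambda>j. \<Sum>t\<in>X. \<phi> t j) # post) = (\<Sum>t\<in>X. det_of_rows (pre @ \<phi> t # post))"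
proof -
  define n k where "n = Suc (length pre + length post)" and "k = length pre"
  define A where "A r = mat n n (\<lambda>(i, j). ((pre @ r # post) ! i) j)" for r
  have A: "det_of_rows (pre @ r # post) = det (A r)" for r
    by (simp add: det_of_rows_def A_def n_def)
  have cofactor: "cofactor (A r) k j = cofactor (A (\<lambda>_. 0)) k j" for r j
  proof -
    have "mat_delete (A r) k j = mat_delete (A (\<lambda>_. 0)) k j"
      by (rule eq_matI) (auto simp: mat_delete_def A_def k_def nth_append nth_Cons')
    then show ?thesis by (simp add: cofactor_def)
  qed
  have "det (A r) = (\<Sum>j<n. r j * cofactor (A (\<lambda>_. 0)) k j)" for r
  proof -
    have "det (A r) = (\<Sum>j<n. A r $$ (k, j) * cofactor (A r) k j)"
      by (rule laplace_expansion_row) (simp_all add: A_def k_def n_def)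
    also have "\<dots> = (\<Sum>j<n. r j * cofactor (A (\<lambda>_. 0)) k j)"
      unfolding cofactor[of r] by (intro sum.cong) (simp_all add: A_def k_def n_def)
    finally show ?thesis .
  qed
  then show ?thesis
    unfolding A by (simp add: sum_distrib_right sum.swap[of _ X])
qed

lemma det_of_rows_differences:
  assumes "\<And>r. r \<in> set (r\<^sub>0 # rs) \<Longrightarrow> r 0 = 1"
  shows "det_of_rows (r\<^sub>0 # rs)
    = det_of_rows (map2 (\<lambda>r r' j. r' (Suc j) - r (Suc j)) (r\<^sub>0 # rs) rs)"
proof -
  let ?R = "r\<^sub>0 # rs" and ?n = "length rs"
  define f where "f i j = (case i of 0 \<Rightarrow> r\<^sub>0 j | Suc i' \<Rightarrow> (?R ! i) j - (?R ! i') j)" for i j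
  have row: "(\<Sum>k\<le>i. f k j) = (?R ! i) j" for i j
    by (induction i) (simp_all add: f_def)
  have one: "(?R ! i) 0 = 1" if "i < Suc ?n" for i
    using that by (intro assms nth_mem) simp
  have "det_of_rows ?R = det (mat (Suc ?n) (Suc ?n) (\<lambda>(i, j). f i j))"
    by (simp add: det_of_rows_def row flip: det_cumulative_rows[of "Suc ?n" f])
  also have "\<dots> = f 0 0 * det (mat ?n ?n (\<lambda>(i, j). f (Suc i) (Suc j)))"
    using one one[of "Suc _"] by (intro det_pivot_column) (simp add: f_def)
  also have "f 0 0 = 1" using assms by (simp add: f_def)
  also have "det (mat ?n ?n (\<lambda>(i, j). f (Suc i) (Suc j)))
      = det_of_rows (map2 (\<lambda>r r' j. r' (Suc j) - r (Suc j)) ?R rs)"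
    by (auto simp: det_of_rows_def f_def intro!: arg_cong[where f = det] eq_matI)
  finally show ?thesis by simp
qed

section \<open>Interlacing sequences\<close>

fun interlaces :: "int list \<Rightarrow> int list \<Rightarrow> bool" where
  "interlaces [a] [] \<longleftrightarrow> True"
| "interlaces (a # b # xs) (t # ts) \<longleftrightarrow> a \<le> t \<and> t < b \<and> interlaces (b # xs) ts"
| "interlaces _ _ \<longleftrightarrow> False"

lemma interlaces_singleton [simp]: "interlaces [a] ts \<longleftrightarrow> ts = []"
  by (cases ts) auto

lemma Collect_interlaces_Cons2:
  "Collect (interlaces (a # b # xs))
     = (\<lambda>(t, ts). t # ts) ` ({a..<b} \<times> Collect (interlaces (b # xs)))"
proof -
  have "interlaces (a # b # xs) ts \<longleftrightarrow>
     ts \<in> (\<lambda>(t, ts). t # ts) ` ({a..<b} \<times> Collect (interlaces (b # xs)))" for ts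
    by (cases ts) (auto simp: image_iff)
  then show ?thesis by blast
qed

lemma interlaces_length: "interlaces xs ts \<Longrightarrow> length xs = Suc (length ts)"
  by (induction xs ts rule: interlaces.induct) auto

lemma interlaces_bounds:
  "interlaces xs ts \<Longrightarrow> sorted_wrt (<) xs \<Longrightarrow> t \<in> set ts \<Longrightarrow> hd xs \<le> t \<and> t < last xs"
proof (induction xs ts rule: interlaces.induct)
  case (2 a b xs t' ts)
  have "b \<le> last (b # xs)"
    using 2(3) last_in_set[of xs] by (cases "xs = []") (auto simp: less_imp_le)
  then show ?case using 2 by (cases "t = t'") fastforce+
qed auto

lemma interlaces_strict_sorted:
  "interlaces xs ts \<Longrightarrow> sorted_wrt (<) xs \<Longrightarrow> sorted_wrt (<) ts"
proof (induction xs ts rule: interlaces.induct)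
  case (2 a b xs t ts)
  have "t < u" if "u \<in> set ts" for u
    using interlaces_bounds[of "b # xs" ts u] 2 that by auto
  then show ?case using 2 by auto
qed auto

lemma sum_det_of_rows_interlaces:
  "xs \<noteq> [] \<Longrightarrow> (\<Sum>ts | interlaces xs ts. det_of_rows (pre @ map \<phi> ts))
     = det_of_rows (pre @ map2 (\<lambda>a b j. \<Sum>t = a..<b. \<phi> t j) xs (tl xs))"
proof (induction xs arbitrary: pre)
  case (Cons a xs)
  show ?case
  proof (cases xs)
    case Nil
    then show ?thesis by simp
  next
    case (Cons b xs')
    let ?rows = "map2 (\<lambda>a b j. \<Sum>t = a..<b. \<phi> t j) xs (tl xs)"
    have "(\<Sum>ts | interlaces (a # xs) ts. det_of_rows (pre @ map \<phi> ts))
        = (\<Sum>t = a..<b. \<Sum>ts | interlaces xs ts. det_of_rows ((pre @ [\<phi> t]) @ map \<phi> ts))"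
      unfolding Cons Collect_interlaces_Cons2
      by (subst sum.reindex) (auto simp: inj_on_def sum.cartesian_product intro!: sum.cong)
    also have "\<dots> = (\<Sum>t = a..<b. det_of_rows (pre @ \<phi> t # ?rows))"
      using Cons Cons.IH[of "pre @ [\<phi> _]"] by simp
    also have "\<dots> = det_of_rows (pre @ (\<lambda>j. \<Sum>t = a..<b. \<phi> t j) # ?rows)"
      by (rule det_of_rows_sum [symmetric])
    finally show ?thesis by (simp add: Cons)
  qed
qed simp

definition binomial_row :: "int \<Rightarrow> nat \<Rightarrow> real" where
  "binomial_row c j = of_int c gchoose j"

lemma sum_binomial_row:
  "a \<le> b \<Longrightarrow> (\<Sum>t = a..<b. binomial_row t j) = binomial_row b (Suc j) - binomial_row a (Suc j)"
proof (induction b rule: int_ge_induct)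
  case (step b)
  have "{a..<b + 1} = insert b {a..<b}" using step by auto
  then show ?case
    using step gbinomial_Suc_Suc[of "of_int b :: real" j]
    by (simp add: binomial_row_def add.commute)
qed simp

lemma sum_det_binomial_rows_interlaces:
  assumes "sorted xs" "xs \<noteq> []"
  shows "(\<Sum>ts | interlaces xs ts. det_of_rows (map binomial_row ts))
    = det_of_rows (map binomial_row xs)"
proof -
  obtain a xs' where xs: "xs = a # xs'" using assms(2) by (cases xs) auto
  have "(\<Sum>ts | interlaces xs ts. det_of_rows (map binomial_row ts))
      = det_of_rows (map2 (\<lambda>a b j. \<Sum>t = a..<b. binomial_row t j) xs xs')"
    using sum_det_of_rows_interlaces[OF assms(2), of "[]" binomial_row] by (simp add: xs)
  also have "map2 (\<lambda>a b j. \<Sum>t = a..<b. binomial_row t j) xs xs'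
      = map2 (\<lambda>a b j. binomial_row b (Suc j) - binomial_row a (Suc j)) xs xs'" (is "?l = ?r")
  proof (rule nth_equalityI)
    fix i assume i: "i < length ?l"
    then have "xs ! i \<le> xs ! Suc i"
      using sorted_nth_mono[OF assms(1), of i "Suc i"] by (simp add: xs)
    with i show "?l ! i = ?r ! i" by (auto simp: xs sum_binomial_row)
  qed simp
  also have "\<dots>
      = map2 (\<lambda>r r' j. r' (Suc j) - r (Suc j)) (map binomial_row xs) (map binomial_row xs')"
    by (simp add: zip_map_map split_def comp_def)
  also have "det_of_rows \<dots> = det_of_rows (map binomial_row xs)"
    unfolding xs list.map
    by (rule det_of_rows_differences [symmetric]) (auto simp: binomial_row_def)
  finally show ?thesis .
qed

lemma det_binomial_rows:
  "det_of_rows (map binomial_row xs)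
     = (\<Prod>i<length xs. \<Prod>l<i. real_of_int (xs ! i - xs ! l)) / (\<Prod>i<length xs. fact i)"
proof -
  define p :: "nat \<Rightarrow> real poly" where
    "p j = smult (1 / fact j) (\<Prod>l<j. [:- real l, 1:])" for j
  have "poly (p j) (of_int c) = binomial_row c j" for j c
    by (simp add: p_def poly_prod binomial_row_def gbinomial_prod_rev lessThan_atLeast0)
  then have "det_of_rows (map binomial_row xs)
      = det (mat (length xs) (length xs) (\<lambda>(i, j). poly (p j) (real_of_int (xs ! i))))"
    unfolding det_of_rows_def by (auto intro!: arg_cong[where f = det] eq_matI)
  also have "\<dots> = det (mat (length xs) (length xs) (\<lambda>(i, j). real_of_int (xs ! i) ^ j))
      * (\<Prod>j<length xs. coeff (p j) j)"
    by (rule det_poly_eval) (simp add: p_def degree_prod_linear)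
  finally show ?thesis
    by (simp add: det_vandermonde p_def coeff_prod_linear prod_dividef)
qed

section \<open>Products of distances\<close>

definition vandermonde :: "int set \<Rightarrow> real" where
  "vandermonde X = (\<Prod>(u, v)\<in>{(u, v) \<in> X \<times> X. u < v}. real_of_int (v - u))"

definition dist_prod :: "int set \<Rightarrow> int set \<Rightarrow> real" where
  "dist_prod X Y = (\<Prod>u\<in>X. \<Prod>v\<in>Y. \<bar>real_of_int (u - v)\<bar>)"

definition mirror :: "int \<Rightarrow> int \<Rightarrow> int" where
  "mirror d i = d - 1 - i"

lemma mirror_mirror [simp]: "mirror d (mirror d i) = i"
  by (simp add: mirror_def)

lemma mirror_image_image [simp]: "mirror d ` mirror d ` S = S"
  by (simp add: image_image)

lemma inj_mirror: "inj_on (mirror d) S"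
  by (auto simp: inj_on_def mirror_def)

lemma mem_mirror_image: "i \<in> mirror d ` S \<longleftrightarrow> mirror d i \<in> S"
  by (metis image_iff mirror_mirror)

lemma dist_prod_commute: "dist_prod X Y = dist_prod Y X"
  unfolding dist_prod_def by (subst prod.swap) (simp add: abs_minus_commute)

lemma dist_prod_Un_left:
  "finite X \<Longrightarrow> finite X' \<Longrightarrow> X \<inter> X' = {} \<Longrightarrow> dist_prod (X \<union> X') Y = dist_prod X Y * dist_prod X' Y"
  unfolding dist_prod_def by (rule prod.union_disjoint)

lemma dist_prod_Un_right:
  "finite Y \<Longrightarrow> finite Y' \<Longrightarrow> Y \<inter> Y' = {} \<Longrightarrow> dist_prod X (Y \<union> Y') = dist_prod X Y * dist_prod X Y'"
  using dist_prod_Un_left[of Y Y' X] by (simp add: dist_prod_commute)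

lemma dist_prod_UN_left:
  "finite I \<Longrightarrow> (\<And>i. i \<in> I \<Longrightarrow> finite (X i)) \<Longrightarrow> disjoint_family_on X I
    \<Longrightarrow> dist_prod (\<Union>i\<in>I. X i) Y = (\<Prod>i\<in>I. dist_prod (X i) Y)"
  unfolding dist_prod_def by (intro prod.UNION_disjoint) (auto simp: disjoint_family_on_def)

lemma dist_prod_pos: "X \<inter> Y = {} \<Longrightarrow> 0 < dist_prod X Y"
  unfolding dist_prod_def by (intro prod_pos) auto

lemma dist_prod_mirror: "dist_prod (mirror d ` X) Y = dist_prod X (mirror d ` Y)"
proof -
  have "\<bar>real_of_int (mirror d u - v)\<bar> = \<bar>real_of_int (u - mirror d v)\<bar>" for u v
    by (simp add: mirror_def)
  then show ?thesis by (simp add: dist_prod_def prod.reindex inj_mirror)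
qed

lemma vandermonde_empty [simp]: "vandermonde {} = 1"
  by (simp add: vandermonde_def)

lemma vandermonde_singleton [simp]: "vandermonde {u} = 1"
  unfolding vandermonde_def by (rule prod.neutral) auto

lemma vandermonde_pos: "0 < vandermonde X"
  unfolding vandermonde_def by (intro prod_pos) auto

lemma vandermonde_mirror: "vandermonde (mirror d ` X) = vandermonde X"
  unfolding vandermonde_def
  by (rule prod.reindex_bij_witness[where i = "\<lambda>(u, v). (mirror d v, mirror d u)"
        and j = "\<lambda>(u, v). (mirror d v, mirror d u)"])
    (auto simp: mirror_def)

lemma vandermonde_Un:
  assumes "finite X" "finite Y" "X \<inter> Y = {}"
  shows "vandermonde (X \<union> Y) = vandermonde X * vandermonde Y * dist_prod X Y"
proof -
  let ?f = "\<lambda>(u, v). real_of_int (v - u)"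
  let ?pairs = "\<lambda>X. {(u, v) \<in> X \<times> X. u < v}"
  let ?mixed = "{(u, v). u < v \<and> (u \<in> X \<and> v \<in> Y \<or> u \<in> Y \<and> v \<in> X)}"
  have fin: "finite (?pairs X)" "finite (?pairs Y)" "finite ?mixed"
    by (rule finite_subset[of _ "(X \<union> Y) \<times> (X \<union> Y)"]; use assms in force)+
  have "?pairs (X \<union> Y) = ?pairs X \<union> (?pairs Y \<union> ?mixed)" by blast
  then have "vandermonde (X \<union> Y) = prod ?f (?pairs X \<union> (?pairs Y \<union> ?mixed))"
    by (simp only: vandermonde_def)
  also have "\<dots> = prod ?f (?pairs X) * (prod ?f (?pairs Y) * prod ?f ?mixed)"
    using fin assms(3) by (subst prod.union_disjoint, auto)+
  also have "prod ?f ?mixed = (\<Prod>(u, v)\<in>X \<times> Y. \<bar>real_of_int (u - v)\<bar>)"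
    using assms(3)
    by (intro prod.reindex_bij_witness[where i = "\<lambda>(u, v). (min u v, max u v)"
          and j = "\<lambda>(u, v). if u \<in> X then (u, v) else (v, u)"])
      (auto simp: min_def max_def split: if_splits)
  also have "\<dots> = dist_prod X Y"
    by (simp add: dist_prod_def prod.cartesian_product)
  finally show ?thesis by (simp add: vandermonde_def mult.assoc)
qed

lemma vandermonde_strict_sorted:
  "sorted_wrt (<) xs \<Longrightarrow> vandermonde (set xs) = (\<Prod>i<length xs. \<Prod>l<i. real_of_int (xs ! i - xs ! l))"
proof (induction xs rule: rev_induct)
  case (snoc w xs)
  then have w: "w \<notin> set xs" "\<And>u. u \<in> set xs \<Longrightarrow> u < w" and sorted: "sorted_wrt (<) xs" "distinct xs"
    by (auto simp: sorted_wrt_append strict_sorted_iff)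
  have "dist_prod {w} (set xs) = (\<Prod>u\<in>set xs. real_of_int (w - u))"
    using w(2) by (auto simp: dist_prod_def less_imp_le intro!: prod.cong)
  also have "\<dots> = (\<Prod>l<length xs. real_of_int (w - xs ! l))"
    by (rule prod.reindex_bij_betw[of "(!) xs", symmetric]) (simp add: bij_betw_nth sorted(2))
  finally show ?case
    using snoc.IH[OF sorted(1)] vandermonde_Un[of "{w}" "set xs"] w(1)
    by (simp add: nth_append)
qed simp

lemma h_0 [simp]: "h 0 = 1" and h_Suc: "h (Suc m) = h m * fact m"
  by (simp_all add: h_def)

lemma h_pos: "0 < h m"
  by (simp add: h_def prod_pos)

lemma h_neq_0 [simp]: "h m \<noteq> 0"
  using h_pos[of m] by simp

lemma vandermonde_atLeastLessThan:
  assumes "u \<le> v"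
  shows "vandermonde {u..<v} = real (h (nat (v - u)))"
proof -
  have "vandermonde {u..<u + int m} = real (h m)" for m
  proof (induction m)
    case (Suc m)
    let ?w = "u + int m"
    have "dist_prod {?w} {u..<?w} = (\<Prod>i\<in>{1..m}. real i)"
      unfolding dist_prod_def
      by (simp, rule prod.reindex_bij_witness[where i = "\<lambda>i. ?w - int i"
            and j = "\<lambda>v. nat (?w - v)"]) auto
    also have "\<dots> = fact m" by (simp add: fact_prod)
    finally have "vandermonde ({?w} \<union> {u..<?w}) = real (h m) * fact m"
      using Suc by (subst vandermonde_Un) auto
    also have "{?w} \<union> {u..<?w} = {u..<u + int (Suc m)}" by auto
    finally show ?case by (simp add: h_Suc)
  qed simp
  from this[of "nat (v - u)"] show ?thesis using assms by simp
qed

text \<open>Expand \<open>{\<alpha>..<\<delta>}\<close>, \<open>{\<alpha>..<\<gamma>}\<close>, \<open>{\<beta>..<\<delta>}\<close> and \<open>{\<beta>..<\<gamma>}\<close>: all pairs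
  except those between the two outer intervals cancel.\<close>

lemma dist_prod_intervals_ordered:
  assumes "\<alpha> \<le> \<beta>" "\<beta> \<le> \<gamma>" "\<gamma> \<le> \<delta>"
  shows "dist_prod {\<alpha>..<\<beta>} {\<gamma>..<\<delta>}
    = real (h (nat (\<delta> - \<alpha>))) * real (h (nat (\<gamma> - \<beta>)))
      / (real (h (nat (\<delta> - \<beta>))) * real (h (nat (\<gamma> - \<alpha>))))"
proof -
  have extend: "real (h (nat (v - \<alpha>)))
      = real (h (nat (\<beta> - \<alpha>))) * real (h (nat (v - \<beta>))) * dist_prod {\<alpha>..<\<beta>} {\<beta>..<v}"
    if "\<beta> \<le> v" for v
    using vandermonde_Un[of "{\<alpha>..<\<beta>}" "{\<beta>..<v}"] assms(1) that
    by (simp add: ivl_disj_un ivl_disj_int vandermonde_atLeastLessThan)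
  have "dist_prod {\<alpha>..<\<beta>} {\<beta>..<\<delta>} = dist_prod {\<alpha>..<\<beta>} {\<beta>..<\<gamma>} * dist_prod {\<alpha>..<\<beta>} {\<gamma>..<\<delta>}"
    using dist_prod_Un_right[of "{\<beta>..<\<gamma>}" "{\<gamma>..<\<delta>}"] assms by (simp add: ivl_disj_un ivl_disj_int)
  moreover have "dist_prod {\<alpha>..<\<beta>} {\<beta>..<\<gamma>} \<noteq> 0"
    using dist_prod_pos[of "{\<alpha>..<\<beta>}" "{\<beta>..<\<gamma>}"] by (simp add: ivl_disj_int)
  ultimately show ?thesis using extend[of \<gamma>] extend[of \<delta>] assms by (simp add: field_simps)
qed

definition h_dist :: "int \<Rightarrow> int \<Rightarrow> real" where
  "h_dist u v = real (h (nat \<bar>u - v\<bar>))"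

lemma dist_prod_intervals:
  assumes "\<alpha> \<le> \<beta>" "\<gamma> \<le> \<delta>" "\<beta> \<le> \<gamma> \<or> \<delta> \<le> \<alpha>"
  shows "dist_prod {\<alpha>..<\<beta>} {\<gamma>..<\<delta>} = h_dist \<alpha> \<delta> * h_dist \<beta> \<gamma> / (h_dist \<beta> \<delta> * h_dist \<alpha> \<gamma>)"
  using assms(3)
proof
  assume "\<beta> \<le> \<gamma>"
  then show ?thesis
    using dist_prod_intervals_ordered[of \<alpha> \<beta> \<gamma> \<delta>] assms(1,2) by (simp add: h_dist_def)
next
  assume "\<delta> \<le> \<alpha>"
  then show ?thesis
    using dist_prod_intervals_ordered[of \<gamma> \<delta> \<alpha> \<beta>] assms(1,2)
    by (simp add: h_dist_def dist_prod_commute mult.commute)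
qed

section \<open>Lattice regions\<close>

lemma mem_vertices:
  "(p, q) \<in> vertices (Up i j) \<longleftrightarrow> i \<le> p \<and> j \<le> q \<and> p + q \<le> i + j + 1"
  "(p, q) \<in> vertices (Down i j) \<longleftrightarrow> p \<le> i + 1 \<and> q \<le> j + 1 \<and> i + j + 1 \<le> p + q"
  by auto

lemma inj_vertices: "inj vertices"
proof (rule injI)
  fix s t assume eq: "vertices s = vertices t"
  show "s = t"
  proof (cases s; cases t)
    fix i j k l assume st: "s = Up i j" "t = Up k l"
    have "(i, j) \<in> vertices t" unfolding eq [symmetric] st(1) by simp
    moreover have "(k, l) \<in> vertices s" unfolding eq st(2) by simp
    ultimately show ?thesis unfolding st mem_vertices by simp
  next
    fix i j k l assume st: "s = Down i j" "t = Down k l"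
    have "(i + 1, j + 1) \<in> vertices t" unfolding eq [symmetric] st(1) by simp
    moreover have "(k + 1, l + 1) \<in> vertices s" unfolding eq st(2) by simp
    ultimately show ?thesis unfolding st mem_vertices by simp
  next
    fix i j k l assume st: "s = Up i j" "t = Down k l"
    have "{(i, j), (i + 1, j), (i, j + 1)} \<subseteq> vertices t"
      unfolding eq [symmetric] st(1) by simp
    then show ?thesis unfolding st(2) insert_subset mem_vertices by linarith
  next
    fix i j k l assume st: "s = Down k l" "t = Up i j"
    have "{(i, j), (i + 1, j), (i, j + 1)} \<subseteq> vertices s"
      unfolding eq st(2) by simp
    then show ?thesis unfolding st(1) insert_subset mem_vertices by linarith
  qed
qed

lemma finite_region_of: "finite P \<Longrightarrow> finite (region_of P)"
  using finite_vimageI[OF _ inj_vertices, of "Pow P"] by (simp add: region_of_def vimage_def)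

lemma Up_in_region_of: "Up i k \<in> region_of P \<longleftrightarrow> (i, k) \<in> P \<and> (i + 1, k) \<in> P \<and> (i, k + 1) \<in> P"
  and Down_in_region_of:
    "Down i k \<in> region_of P \<longleftrightarrow> (i + 1, k) \<in> P \<and> (i, k + 1) \<in> P \<and> (i + 1, k + 1) \<in> P"
  by (simp_all add: region_of_def)

lemma region_eqI:
  "(\<And>i k. Up i k \<in> R \<longleftrightarrow> Up i k \<in> R') \<Longrightarrow> (\<And>i k. Down i k \<in> R \<longleftrightarrow> Down i k \<in> R') \<Longrightarrow> R = R'"
  by (metis subsetI subset_antisym unit_triangle.exhaust)

lemma mem_up_triangle:
  "Up i k \<in> up_triangle (p, q) b \<longleftrightarrow> p \<le> i \<and> q \<le> k \<and> i + k + 1 \<le> p + q + int b"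
  "Down i k \<in> up_triangle (p, q) b \<longleftrightarrow> p \<le> i \<and> q \<le> k \<and> i + k + 2 \<le> p + q + int b"
  by (auto simp: up_triangle_def Up_in_region_of Down_in_region_of)

lemma mem_down_triangle:
  "Up i k \<in> down_triangle (p, q) b \<longleftrightarrow> i + 1 \<le> p + int b \<and> k + 1 \<le> q \<and> p + q \<le> i + k"
  "Down i k \<in> down_triangle (p, q) b \<longleftrightarrow> i + 1 \<le> p + int b \<and> k + 1 \<le> q \<and> p + q \<le> i + k + 1"
  by (auto simp: down_triangle_def Up_in_region_of Down_in_region_of)

lemma mem_hexagon:
  "Up i k \<in> hexagon X Y Z \<longleftrightarrow> 0 \<le> i \<and> i + 1 \<le> int X + int Y \<and> - int Y \<le> k \<and> k + 1 \<le> int Z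
     \<and> 0 \<le> i + k \<and> i + k + 1 \<le> int X + int Z"
  "Down i k \<in> hexagon X Y Z \<longleftrightarrow> 0 \<le> i \<and> i + 1 \<le> int X + int Y \<and> - int Y \<le> k \<and> k + 1 \<le> int Z
     \<and> 0 \<le> i + k + 1 \<and> i + k + 2 \<le> int X + int Z"
  by (auto simp: hexagon_def Up_in_region_of Down_in_region_of)

lemma finite_hexagon: "finite (hexagon X Y Z)"
  unfolding hexagon_def
proof (rule finite_region_of, rule finite_subset)
  show "{(i, j). 0 \<le> i \<and> i \<le> int X + int Y \<and> - int Y \<le> j \<and> j \<le> int Z
        \<and> 0 \<le> i + j \<and> i + j \<le> int X + int Z}
      \<subseteq> {0..int X + int Y} \<times> {- int Y..int Z}" by auto
qed simp

section \<open>Lozenges and tilings\<close>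

lemma
  assumes "(p, q) \<noteq> (p', q')"
  shows Up_Up_shared_edge:
      "\<lbrakk>{(p, q), (p', q')} \<subseteq> vertices (Up i j); {(p, q), (p', q')} \<subseteq> vertices (Up k l)\<rbrakk>
      \<Longrightarrow> k = i \<and> l = j"
    and Down_Down_shared_edge:
      "\<lbrakk>{(p, q), (p', q')} \<subseteq> vertices (Down i j); {(p, q), (p', q')} \<subseteq> vertices (Down k l)\<rbrakk>
      \<Longrightarrow> k = i \<and> l = j"
    and Up_Down_shared_edge:
      "\<lbrakk>{(p, q), (p', q')} \<subseteq> vertices (Up i j); {(p, q), (p', q')} \<subseteq> vertices (Down k l)\<rbrakk>
      \<Longrightarrow> k = i \<and> l = j \<or> k = i - 1 \<and> l = j \<or> k = i \<and> l = j - 1"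
  using assms unfolding insert_subset mem_vertices prod.inject by smt+

lemma is_lozengeI:
  shows "is_lozenge {Up i j, Down i j}" "is_lozenge {Up i j, Down (i - 1) j}"
    and "is_lozenge {Up i j, Down i (j - 1)}"
proof -
  have "vertices (Up i j) \<inter> vertices (Down i j) = {(i + 1, j), (i, j + 1)}"
    "vertices (Up i j) \<inter> vertices (Down (i - 1) j) = {(i, j), (i, j + 1)}"
    "vertices (Up i j) \<inter> vertices (Down i (j - 1)) = {(i, j), (i + 1, j)}"
    by auto
  then have "card (vertices (Up i j) \<inter> vertices (Down i j)) = 2"
    "card (vertices (Up i j) \<inter> vertices (Down (i - 1) j)) = 2"
    "card (vertices (Up i j) \<inter> vertices (Down i (j - 1))) = 2"
    by simp_all
  then show "is_lozenge {Up i j, Down i j}" "is_lozenge {Up i j, Down (i - 1) j}"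
    "is_lozenge {Up i j, Down i (j - 1)}"
    unfolding is_lozenge_def by blast+
qed

lemma is_lozenge_iff:
  "is_lozenge L \<longleftrightarrow> (\<exists>i j. L = {Up i j, Down i j} \<or> L = {Up i j, Down (i - 1) j}
     \<or> L = {Up i j, Down i (j - 1)})" (is "_ \<longleftrightarrow> ?R")
proof
  assume "is_lozenge L"
  then obtain s t v w where st: "L = {s, t}" "s \<noteq> t" "vertices s \<inter> vertices t = {v, w}" "v \<noteq> w"
    by (auto simp: is_lozenge_def card_2_iff)
  obtain p q p' q' where vw: "v = (p, q)" "w = (p', q')" by fastforce
  have edge: "(p, q) \<noteq> (p', q')" "{(p, q), (p', q')} \<subseteq> vertices s" "{(p, q), (p', q')} \<subseteq> vertices t"
    using st(3,4) unfolding vw by blast+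
  have adjacent: "k = i \<and> l = j \<or> k = i - 1 \<and> l = j \<or> k = i \<and> l = j - 1"
    if "{(p, q), (p', q')} \<subseteq> vertices (Up i j)" "{(p, q), (p', q')} \<subseteq> vertices (Down k l)"
    for i j k l
    using that by (rule Up_Down_shared_edge[OF edge(1)])
  show ?R
  proof (cases s; cases t)
    fix i j k l assume "s = Up i j" "t = Down k l"
    then show ?R using adjacent[of i j k l] edge(2,3) st(1) by metis
  next
    fix i j k l assume "s = Down k l" "t = Up i j"
    then show ?R using adjacent[of i j k l] edge(2,3) st(1) by (metis insert_commute)
  next
    fix i j k l assume "s = Up i j" "t = Up k l"
    then show ?R using Up_Up_shared_edge[OF edge(1)] edge(2,3) st(2) by metis
  next
    fix i j k l assume "s = Down i j" "t = Down k l"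
    then show ?R using Down_Down_shared_edge[OF edge(1)] edge(2,3) st(2) by metis
  qed
qed (use is_lozengeI in auto)

lemma is_lozenge_Up: "is_lozenge {Up i j, v} \<longleftrightarrow> v \<in> {Down i j, Down (i - 1) j, Down i (j - 1)}"
  by (auto simp: is_lozenge_iff doubleton_eq_iff)

lemma is_lozenge_Down: "is_lozenge {Down i j, v} \<longleftrightarrow> v \<in> {Up i j, Up (i + 1) j, Up i (j + 1)}"
proof (cases v)
  case (Up k l)
  have "is_lozenge {Down i j, v} \<longleftrightarrow> is_lozenge {v, Down i j}" by (simp add: insert_commute)
  then show ?thesis unfolding Up is_lozenge_Up by auto
qed (auto simp: is_lozenge_iff doubleton_eq_iff)

lemma is_lozenge_nonempty: "is_lozenge L \<Longrightarrow> L \<noteq> {}"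
  by (auto simp: is_lozenge_def)

definition tilings :: "region \<Rightarrow> unit_triangle set set set" where
  "tilings R = {T. is_tiling R T}"

lemma M_eq_card_tilings: "M R = card (tilings R)"
  by (simp add: M_def tilings_def)

lemma tilingsI:
  "\<lbrakk>\<And>L. L \<in> T \<Longrightarrow> is_lozenge L; \<And>L L'. \<lbrakk>L \<in> T; L' \<in> T; L \<noteq> L'\<rbrakk> \<Longrightarrow> L \<inter> L' = {}; \<Union>T = R\<rbrakk>
     \<Longrightarrow> T \<in> tilings R"
  by (auto simp: tilings_def is_tiling_def pairwise_def disjnt_def)

lemma tilingsD:
  assumes "T \<in> tilings R"
  shows "L \<in> T \<Longrightarrow> is_lozenge L" "L \<in> T \<Longrightarrow> L' \<in> T \<Longrightarrow> L \<noteq> L' \<Longrightarrow> L \<inter> L' = {}" "\<Union>T = R"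
  using assms by (auto simp: tilings_def is_tiling_def pairwise_def disjnt_def)

lemma finite_tilings: "finite R \<Longrightarrow> finite (tilings R)"
  by (rule finite_subset[of _ "Pow (Pow R)"]) (auto dest: tilingsD(3))

lemma tilings_empty: "tilings {} = {{}}"
proof -
  have "T = {}" if "T \<in> tilings {}" for T
    using tilingsD(1,3)[OF that] is_lozenge_nonempty by blast
  moreover have "{} \<in> tilings {}" by (rule tilingsI) auto
  ultimately show ?thesis by blast
qed

lemma M_empty [simp]: "M {} = 1"
  by (simp add: M_eq_card_tilings tilings_empty)

lemma tiling_lozengeE:
  assumes "T \<in> tilings R" "t \<in> R"
  obtains u where "{t, u} \<in> T" "is_lozenge {t, u}" "u \<in> R"
proof -
  obtain L where L: "L \<in> T" "t \<in> L" using tilingsD(3)[OF assms(1)] assms(2) by blast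
  then obtain u where "L = {t, u}"
    using tilingsD(1)[OF assms(1)] unfolding is_lozenge_def by blast
  then show thesis using that L tilingsD(1,3)[OF assms(1)] by blast
qed

lemma tilings_subset:
  assumes "T \<in> tilings R" "P \<subseteq> T"
  shows "P \<in> tilings (\<Union>P)"
  using tilingsD[OF assms(1)] assms(2) by (intro tilingsI) blast+

lemma tilings_Diff:
  assumes "T \<in> tilings R" "P \<subseteq> T"
  shows "T - P \<in> tilings (R - \<Union>P)"
proof -
  have "\<Union>(T - P) = R - \<Union>P" using tilingsD[OF assms(1)] assms(2) by blast
  then show ?thesis using tilings_subset[OF assms(1), of "T - P"] by simp
qed

lemma tilings_Un:
  assumes T: "T\<^sub>1 \<in> tilings A" "T\<^sub>2 \<in> tilings B" and disj: "A \<inter> B = {}"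
  shows "T\<^sub>1 \<union> T\<^sub>2 \<in> tilings (A \<union> B)"
proof (rule tilingsI)
  note D\<^sub>1 = tilingsD[OF T(1)] and D\<^sub>2 = tilingsD[OF T(2)]
  show "\<Union>(T\<^sub>1 \<union> T\<^sub>2) = A \<union> B" using D\<^sub>1(3) D\<^sub>2(3) by blast
  show "is_lozenge L" if "L \<in> T\<^sub>1 \<union> T\<^sub>2" for L using D\<^sub>1(1) D\<^sub>2(1) that by blast
  show "L \<inter> L' = {}" if "L \<in> T\<^sub>1 \<union> T\<^sub>2" "L' \<in> T\<^sub>1 \<union> T\<^sub>2" "L \<noteq> L'" for L L'
    using D\<^sub>1(2,3) D\<^sub>2(2,3) disj that by blast
qed

lemma tilings_disjoint:
  assumes "T\<^sub>1 \<in> tilings A" "T\<^sub>2 \<in> tilings B" "A \<inter> B = {}"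
  shows "T\<^sub>1 \<inter> T\<^sub>2 = {}"
  using tilingsD(1,3)[OF assms(1)] tilingsD(3)[OF assms(2)] assms(3) is_lozenge_nonempty by blast

lemma M_forced:
  assumes forced: "\<And>T. T \<in> tilings R \<Longrightarrow> P \<subseteq> T" and P: "P \<in> tilings (\<Union>P)" "\<Union>P \<subseteq> R"
  shows "M R = M (R - \<Union>P)"
proof -
  have "bij_betw (\<lambda>T. T - P) (tilings R) (tilings (R - \<Union>P))"
  proof (rule bij_betw_byWitness[where f' = "\<lambda>T. T \<union> P"])
    show "\<forall>T\<in>tilings R. T - P \<union> P = T" using forced by blast
    show "\<forall>T\<in>tilings (R - \<Union>P). T \<union> P - P = T" using tilings_disjoint[OF _ P(1)] by blast
    show "(\<lambda>T. T - P) ` tilings R \<subseteq> tilings (R - \<Union>P)" using tilings_Diff forced by blast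
    have "T \<union> P \<in> tilings R" if "T \<in> tilings (R - \<Union>P)" for T
      using tilings_Un[OF that P(1)] P(2) by (simp add: Un_absorb2 Int_commute)
    then show "(\<lambda>T. T \<union> P) ` tilings (R - \<Union>P) \<subseteq> tilings R" by blast
  qed
  then show ?thesis by (simp add: M_eq_card_tilings bij_betw_same_card)
qed

lemma M_forced_lozenge:
  assumes "t \<in> R" "u \<in> R" "is_lozenge {t, u}"
    and "\<And>v. is_lozenge {t, v} \<Longrightarrow> v \<in> R \<Longrightarrow> v = u"
  shows "M R = M (R - {t, u})"
proof -
  have "{{t, u}} \<subseteq> T" if "T \<in> tilings R" for T
    using tiling_lozengeE[OF that assms(1)] assms(4) by blast
  moreover have "{{t, u}} \<in> tilings (\<Union>{{t, u}})" using assms(3) by (intro tilingsI) auto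
  ultimately show ?thesis using M_forced[of R "{{t, u}}"] assms(1,2) by simp
qed

lemma M_isolated:
  assumes "t \<in> R" and "\<And>v. is_lozenge {t, v} \<Longrightarrow> v \<notin> R"
  shows "M R = 0"
proof -
  have "tilings R = {}" using tiling_lozengeE[OF _ assms(1)] assms(2) by blast
  then show ?thesis by (simp add: M_eq_card_tilings)
qed

section \<open>Cutting a region in two\<close>

definition straddlings :: "region \<Rightarrow> region \<Rightarrow> unit_triangle set set set" where
  "straddlings A B = {C. C \<in> tilings (\<Union>C) \<and> \<Union>C \<subseteq> A \<union> B \<and> (\<forall>L\<in>C. \<not> L \<subseteq> A \<and> \<not> L \<subseteq> B)}"

lemma finite_straddlings: "finite A \<Longrightarrow> finite B \<Longrightarrow> finite (straddlings A B)"
  by (rule finite_subset[of _ "Pow (Pow (A \<union> B))"]) (auto simp: straddlings_def)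

lemma tiling_cut:
  assumes T: "T \<in> tilings (A \<union> B)" and disj: "A \<inter> B = {}"
  shows "T - Pow A - Pow B \<in> straddlings A B"
    and "T \<inter> Pow A \<in> tilings (A - \<Union>(T - Pow A - Pow B))"
proof -
  let ?C = "T - Pow A - Pow B"
  note D = tilingsD[OF T]
  show "?C \<in> straddlings A B"
    using tilings_subset[OF T, of ?C] D(3) by (auto simp: straddlings_def)
  define X Y where "X = \<Union>(T - Pow A)" and "Y = \<Union>?C"
  have "A \<inter> X \<subseteq> Y"
  proof
    fix t assume "t \<in> A \<inter> X"
    then obtain L where L: "L \<in> T - Pow A" "t \<in> L" "t \<in> A" unfolding X_def by blast
    then have "L \<in> ?C" using disj by blast
    with L(2) show "t \<in> Y" unfolding Y_def by blast
  qed
  moreover have "Y \<subseteq> X" unfolding X_def Y_def by blast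
  moreover have "B \<subseteq> X" unfolding X_def using D(3) disj by blast
  ultimately have "A \<union> B - X = A - Y" by blast
  then show "T \<inter> Pow A \<in> tilings (A - \<Union>?C)"
    using tilings_Diff[OF T, of "T - Pow A"] by (simp add: Diff_Diff_Int X_def Y_def)
qed

lemma tiling_glue:
  assumes disj: "A \<inter> B = {}" and C: "C \<in> straddlings A B"
    and T\<^sub>1: "T\<^sub>1 \<in> tilings (A - \<Union>C)" and T\<^sub>2: "T\<^sub>2 \<in> tilings (B - \<Union>C)"
  shows "C \<union> T\<^sub>1 \<union> T\<^sub>2 \<in> tilings (A \<union> B)"
    and "(C \<union> T\<^sub>1 \<union> T\<^sub>2) \<inter> Pow A = T\<^sub>1" and "(C \<union> T\<^sub>1 \<union> T\<^sub>2) \<inter> Pow B = T\<^sub>2"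
    and "C \<union> T\<^sub>1 \<union> T\<^sub>2 - Pow A - Pow B = C"
proof -
  have C': "C \<in> tilings (\<Union>C)" "\<Union>C \<subseteq> A \<union> B" "\<And>L. L \<in> C \<Longrightarrow> \<not> L \<subseteq> A \<and> \<not> L \<subseteq> B"
    using C by (auto simp: straddlings_def)
  have "C \<union> T\<^sub>1 \<union> T\<^sub>2 \<in> tilings (\<Union>C \<union> (A - \<Union>C) \<union> (B - \<Union>C))"
    using disj by (intro tilings_Un C' T\<^sub>1 T\<^sub>2) auto
  also have "\<Union>C \<union> (A - \<Union>C) \<union> (B - \<Union>C) = A \<union> B" using C'(2) by blast
  finally show "C \<union> T\<^sub>1 \<union> T\<^sub>2 \<in> tilings (A \<union> B)" .
  have "L \<subseteq> A" "\<not> L \<subseteq> B" if "L \<in> T\<^sub>1" for L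
    using tilingsD(1,3)[OF T\<^sub>1] is_lozenge_nonempty[of L] that disj by blast+
  moreover have "L \<subseteq> B" "\<not> L \<subseteq> A" if "L \<in> T\<^sub>2" for L
    using tilingsD(1,3)[OF T\<^sub>2] is_lozenge_nonempty[of L] that disj by blast+
  ultimately show "(C \<union> T\<^sub>1 \<union> T\<^sub>2) \<inter> Pow A = T\<^sub>1" "(C \<union> T\<^sub>1 \<union> T\<^sub>2) \<inter> Pow B = T\<^sub>2"
    "C \<union> T\<^sub>1 \<union> T\<^sub>2 - Pow A - Pow B = C"
    using C'(3) by blast+
qed

theorem M_Un:
  assumes "finite A" "finite B" and disj: "A \<inter> B = {}"
  shows "M (A \<union> B) = (\<Sum>C\<in>straddlings A B. M (A - \<Union>C) * M (B - \<Union>C))"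
proof -
  let ?S = "SIGMA C:straddlings A B. tilings (A - \<Union>C) \<times> tilings (B - \<Union>C)"
  have cut_B: "T \<inter> Pow B \<in> tilings (B - \<Union>(T - Pow A - Pow B))" if "T \<in> tilings (A \<union> B)" for T
    using tiling_cut(2)[of T B A] that disj by (simp add: Un_commute Int_commute Diff_eq Int_ac)
  have "bij_betw (\<lambda>T. (T - Pow A - Pow B, T \<inter> Pow A, T \<inter> Pow B)) (tilings (A \<union> B)) ?S"
    by (rule bij_betw_byWitness[where f' = "\<lambda>(C, T\<^sub>1, T\<^sub>2). C \<union> T\<^sub>1 \<union> T\<^sub>2"])
      (use tiling_cut[OF _ disj] cut_B tiling_glue[OF disj] in auto)
  then have "M (A \<union> B) = card ?S" by (simp add: M_eq_card_tilings bij_betw_same_card)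
  then show ?thesis
    using assms
    by (simp add: M_eq_card_tilings finite_tilings finite_straddlings card_cartesian_product)
qed

section \<open>Rotations\<close>

lemma rotate_triangle_involution [simp]: "rotate_triangle d (rotate_triangle d t) = t"
  by (cases d; cases t) auto

lemma rotate_triangle_image_image [simp]: "rotate_triangle d ` rotate_triangle d ` A = A"
  by (simp add: image_image)

lemma inj_rotate_triangle: "inj (rotate_triangle d)"
  by (metis injI rotate_triangle_involution)

lemma mem_rotate_triangle_image: "t \<in> rotate_triangle d ` A \<longleftrightarrow> rotate_triangle d t \<in> A"
  by (metis image_iff rotate_triangle_involution)

lemma rotate_triangle_image_eqI:
  "(\<And>t. t \<in> A \<Longrightarrow> rotate_triangle d t \<in> A) \<Longrightarrow> rotate_triangle d ` A = A"
  using mem_rotate_triangle_image by (metis rotate_triangle_involution subsetI subset_antisym)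

lemma is_lozenge_rotate: "is_lozenge (rotate_triangle d ` L)" if "is_lozenge L"
proof -
  obtain s t where st: "L = {s, t}" "s \<noteq> t" "card (vertices s \<inter> vertices t) = 2"
    using \<open>is_lozenge L\<close> by (auto simp: is_lozenge_def)
  have inj: "inj (rotate_point d)" by (cases d) (auto simp: inj_on_def)
  have "vertices (rotate_triangle d s) \<inter> vertices (rotate_triangle d t)
      = rotate_point d ` (vertices s \<inter> vertices t)"
    by (simp add: vertices_rotate_triangle image_Int[OF inj])
  then have "card (vertices (rotate_triangle d s) \<inter> vertices (rotate_triangle d t)) = 2"
    using st(3) inj by (simp add: card_image inj_on_subset)
  moreover have "rotate_triangle d s \<noteq> rotate_triangle d t"
    using st(2) by (metis rotate_triangle_involution)
  ultimately show ?thesis using st(1) by (auto simp: is_lozenge_def)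
qed

abbreviation rotate_tiling :: "point \<Rightarrow> unit_triangle set set \<Rightarrow> unit_triangle set set" where
  "rotate_tiling d T \<equiv> (`) (rotate_triangle d) ` T"

lemma rotate_tiling_involution [simp]: "rotate_tiling d (rotate_tiling d T) = T"
  by (simp add: image_image)

lemma Union_rotate_tiling: "\<Union>(rotate_tiling d T) = rotate_triangle d ` \<Union>T"
  by blast

lemma rotate_tiling_in_tilings:
  assumes T: "T \<in> tilings R"
  shows "rotate_tiling d T \<in> tilings (rotate_triangle d ` R)"
proof (rule tilingsI)
  note D = tilingsD[OF T]
  show "\<Union>(rotate_tiling d T) = rotate_triangle d ` R"
    by (simp add: Union_rotate_tiling D(3))
  fix L assume "L \<in> rotate_tiling d T"
  then show "is_lozenge L" using D(1) is_lozenge_rotate by blast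
  fix L' assume "L' \<in> rotate_tiling d T" "L \<noteq> L'"
  with \<open>L \<in> _\<close> obtain K K' where "K \<in> T" "K' \<in> T" "K \<noteq> K'"
      "L = rotate_triangle d ` K" "L' = rotate_triangle d ` K'" by blast
  then show "L \<inter> L' = {}"
    using D(2)[of K K'] image_Int[OF inj_rotate_triangle, of d K K'] by auto
qed

lemma M_rotate: "M (rotate_triangle d ` R) = M R"
proof -
  have "bij_betw (rotate_tiling d) (tilings R) (tilings (rotate_triangle d ` R))"
  proof (rule bij_betw_byWitness[where f' = "rotate_tiling d"])
    show "rotate_tiling d ` tilings (rotate_triangle d ` R) \<subseteq> tilings R"
      using rotate_tiling_in_tilings[of _ "rotate_triangle d ` R" d] by auto
  qed (auto intro: rotate_tiling_in_tilings)
  then show ?thesis by (simp add: M_eq_card_tilings bij_betw_same_card)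
qed

lemma rotate_tiling_Int_Pow:
  "rotate_tiling d T \<inter> Pow (rotate_triangle d ` A) = rotate_tiling d (T \<inter> Pow A)"
  using inj_image_subset_iff[OF inj_rotate_triangle[of d]] by blast

lemma rotate_tiling_cut:
  fixes d :: point and A :: region
  defines "B \<equiv> rotate_triangle d ` A"
  assumes T: "rotate_tiling d T = T"
  shows "rotate_tiling d (T \<inter> Pow A) = T \<inter> Pow B"
    and "rotate_tiling d (T - Pow A - Pow B) = T - Pow A - Pow B"
proof -
  show A: "rotate_tiling d (T \<inter> Pow A) = T \<inter> Pow B"
    using rotate_tiling_Int_Pow[of d T A] T by (simp add: B_def)
  have B: "rotate_tiling d (T \<inter> Pow B) = T \<inter> Pow A"
    using A by (metis rotate_tiling_involution)
  have "inj ((`) (rotate_triangle d))"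
    by (intro injI) (simp add: inj_image_eq_iff[OF inj_rotate_triangle])
  then have "rotate_tiling d (T - T \<inter> Pow A - T \<inter> Pow B) = T - T \<inter> Pow B - T \<inter> Pow A"
    by (simp only: image_set_diff T A B)
  moreover have "T - Pow A - Pow B = T - T \<inter> Pow A - T \<inter> Pow B"
    "T - Pow A - Pow B = T - T \<inter> Pow B - T \<inter> Pow A" by blast+
  ultimately show "rotate_tiling d (T - Pow A - Pow B) = T - Pow A - Pow B" by simp
qed

theorem M_odot_Un_rotate:
  fixes d :: point and A :: region
  defines "B \<equiv> rotate_triangle d ` A"
  assumes fin: "finite A" and disj: "A \<inter> B = {}"
  shows "M_odot d (A \<union> B) = (\<Sum>C | C \<in> straddlings A B \<and> rotate_tiling d C = C. M (A - \<Union>C))"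
proof -
  let ?\<T> = "{T \<in> tilings (A \<union> B). rotate_tiling d T = T}"
  let ?\<C> = "{C \<in> straddlings A B. rotate_tiling d C = C}"
  let ?S = "SIGMA C:?\<C>. tilings (A - \<Union>C)"
  let ?cut = "\<lambda>T. (T - Pow A - Pow B, T \<inter> Pow A)" and ?glue = "\<lambda>(C, T). C \<union> T \<union> rotate_tiling d T"
  have rotated: "rotate_tiling d T \<in> tilings (B - \<Union>C)"
    if "rotate_tiling d C = C" "T \<in> tilings (A - \<Union>C)" for C T
  proof -
    have "rotate_triangle d ` (A - \<Union>C) = B - \<Union>C"
      using that(1)
      by (simp add: image_set_diff[OF inj_rotate_triangle] B_def flip: Union_rotate_tiling)
    then show ?thesis using rotate_tiling_in_tilings[OF that(2)] by metis
  qed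
  have "bij_betw ?cut ?\<T> ?S"
  proof (rule bij_betw_byWitness[where f' = ?glue])
    show "\<forall>T\<in>?\<T>. ?glue (?cut T) = T" using rotate_tiling_cut(1)[of d _ A] unfolding B_def by auto
    show "\<forall>p\<in>?S. ?cut (?glue p) = p" using tiling_glue(2,4)[OF disj _ _ rotated] by auto
    show "?cut ` ?\<T> \<subseteq> ?S"
    proof (intro image_subsetI, elim CollectE conjE)
      fix T assume "T \<in> tilings (A \<union> B)" "rotate_tiling d T = T"
      then show "?cut T \<in> ?S"
        using tiling_cut[OF _ disj, of T] rotate_tiling_cut(2)[of d T A] by (simp add: B_def)
    qed
    show "?glue ` ?S \<subseteq> ?\<T>"
      using tiling_glue(1)[OF disj _ _ rotated] by (auto simp: image_Un Un_ac)
  qed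
  then have "M_odot d (A \<union> B) = card ?S"
    by (simp add: M_odot_def tilings_def bij_betw_same_card)
  also have "\<dots> = (\<Sum>C\<in>?\<C>. M (A - \<Union>C))"
    using fin by (simp add: M_eq_card_tilings finite_tilings finite_straddlings B_def)
  finally show ?thesis .
qed

section \<open>Cutting along a horizontal line\<close>

fun triangle_row :: "unit_triangle \<Rightarrow> int" where
  "triangle_row (Up i j) = j"
| "triangle_row (Down i j) = j"

definition upper :: "int \<Rightarrow> region \<Rightarrow> region" where
  "upper j R = {t \<in> R. j \<le> triangle_row t}"

definition lower :: "int \<Rightarrow> region \<Rightarrow> region" where
  "lower j R = {t \<in> R. triangle_row t < j}"

definition crossing :: "int \<Rightarrow> region \<Rightarrow> int set" where
  "crossing j R = {i. Up i j \<in> R \<and> Down i (j - 1) \<in> R}"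

definition ups :: "int \<Rightarrow> int set \<Rightarrow> region" where
  "ups j S = (\<lambda>i. Up i j) ` S"

definition downs :: "int \<Rightarrow> int set \<Rightarrow> region" where
  "downs j S = (\<lambda>i. Down i j) ` S"

definition vertical :: "int \<Rightarrow> int \<Rightarrow> unit_triangle set" where
  "vertical j i = {Up i j, Down i (j - 1)}"

lemma Up_in_ups [simp]: "Up i k \<in> ups j S \<longleftrightarrow> k = j \<and> i \<in> S"
  and Down_in_ups [simp]: "Down i k \<notin> ups j S"
  and Up_in_downs [simp]: "Up i k \<notin> downs j S"
  and Down_in_downs [simp]: "Down i k \<in> downs j S \<longleftrightarrow> k = j \<and> i \<in> S"
  by (auto simp: ups_def downs_def)

lemma upper_Un_lower: "upper j R \<union> lower j R = R" and upper_Int_lower: "upper j R \<inter> lower j R = {}"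
  by (auto simp: upper_def lower_def)

lemma finite_upper [simp]: "finite R \<Longrightarrow> finite (upper j R)"
  and finite_lower [simp]: "finite R \<Longrightarrow> finite (lower j R)"
  by (simp_all add: upper_def lower_def)

lemma inj_vertical: "inj (vertical j)"
  by (auto simp: inj_def vertical_def doubleton_eq_iff)

lemma Union_vertical: "\<Union>(vertical j ` S) = ups j S \<union> downs (j - 1) S"
  by (auto simp: vertical_def ups_def downs_def)

lemma upper_minus_vertical: "upper j R - \<Union>(vertical j ` S) = upper j R - ups j S"
  and lower_minus_vertical: "lower j R - \<Union>(vertical j ` S) = lower j R - downs (j - 1) S"
  unfolding Union_vertical by (auto simp: upper_def lower_def ups_def downs_def)

lemma lozenge_trichotomy:
  assumes "is_lozenge L"
  obtains "L \<subseteq> {t. j \<le> triangle_row t}" | "L \<subseteq> {t. triangle_row t < j}" | i where "L = vertical j i"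
proof -
  obtain i k where "L = {Up i k, Down i k} \<or> L = {Up i k, Down (i - 1) k}
      \<or> L = {Up i k, Down i (k - 1)}"
    using assms unfolding is_lozenge_iff by blast
  then have "(\<forall>t\<in>L. triangle_row t = k) \<or> L = vertical k i"
    by (elim disjE) (simp_all add: vertical_def)
  then have "L \<subseteq> {t. j \<le> triangle_row t} \<or> L \<subseteq> {t. triangle_row t < j} \<or> L = vertical j i"
    by (cases k j rule: linorder_cases) (auto simp: vertical_def)
  then show thesis using that by blast
qed

lemma straddlings_upper_lower:
  "straddlings (upper j R) (lower j R) = (`) (vertical j) ` Pow (crossing j R)"
proof (intro equalityI subsetI)
  fix C assume C: "C \<in> straddlings (upper j R) (lower j R)"
  have "L \<in> vertical j ` crossing j R" if "L \<in> C" for L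
  proof -
    have L: "is_lozenge L" "L \<subseteq> R" "\<not> L \<subseteq> upper j R" "\<not> L \<subseteq> lower j R"
      using C that tilingsD(1)[of C "\<Union>C" L] by (auto simp: straddlings_def upper_Un_lower)
    from L(1) show ?thesis
    proof (cases rule: lozenge_trichotomy[of _ j])
      case (3 i)
      then show ?thesis using L(2) by (auto simp: vertical_def crossing_def)
    qed (use L in \<open>auto simp: upper_def lower_def\<close>)
  qed
  then have "C \<subseteq> vertical j ` crossing j R" by blast
  then show "C \<in> (`) (vertical j) ` Pow (crossing j R)" by (auto elim!: subset_imageE)
next
  fix C assume "C \<in> (`) (vertical j) ` Pow (crossing j R)"
  then obtain S where S: "C = vertical j ` S" "S \<subseteq> crossing j R" by blast
  have "C \<in> tilings (\<Union>C)"
    by (rule tilingsI) (auto simp: S(1) vertical_def is_lozenge_Up)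
  moreover have "\<Union>C \<subseteq> R"
    using S(2) unfolding S(1) by (auto simp: vertical_def crossing_def)
  moreover have "\<forall>L\<in>C. \<not> L \<subseteq> upper j R \<and> \<not> L \<subseteq> lower j R"
    by (auto simp: S(1) vertical_def upper_def lower_def)
  ultimately show "C \<in> straddlings (upper j R) (lower j R)"
    by (simp add: straddlings_def upper_Un_lower)
qed

theorem M_cut_row:
  assumes "finite R"
  shows "M R = (\<Sum>S\<in>Pow (crossing j R). M (upper j R - ups j S) * M (lower j R - downs (j - 1) S))"
proof -
  have "M R = (\<Sum>C\<in>(`) (vertical j) ` Pow (crossing j R). M (upper j R - \<Union>C) * M (lower j R - \<Union>C))"
    using M_Un[of "upper j R" "lower j R"] assms
    by (simp add: upper_Un_lower upper_Int_lower straddlings_upper_lower)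
  also have "\<dots> = (\<Sum>S\<in>Pow (crossing j R).
      M (upper j R - \<Union>(vertical j ` S)) * M (lower j R - \<Union>(vertical j ` S)))"
    by (rule sum.reindex_cong[OF _ refl refl])
      (simp add: inj_on_def inj_image_eq_iff[OF inj_vertical])
  finally show ?thesis by (simp only: upper_minus_vertical lower_minus_vertical)
qed

lemma triangle_row_rotate:
  "triangle_row (rotate_triangle (d, 2 * j) t) = 2 * j - 1 - triangle_row t"
  by (cases t) simp_all

lemma rotate_vertical:
  "rotate_tiling (d, 2 * j) (vertical j ` S) = vertical j ` mirror d ` S"
proof -
  have "rotate_triangle (d, 2 * j) ` vertical j i = vertical j (mirror d i)" for i
    by (auto simp: vertical_def mirror_def)
  then show ?thesis by (simp add: image_image)
qed

lemma lower_eq_rotate_upper: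
  assumes "rotate_triangle (d, 2 * j) ` R = R"
  shows "lower j R = rotate_triangle (d, 2 * j) ` upper j R"
proof -
  have "rotate_triangle (d, 2 * j) t \<in> R \<longleftrightarrow> t \<in> R" for t
    using mem_rotate_triangle_image[of t "(d, 2 * j)" R] assms by simp
  then show ?thesis
    by (auto simp: set_eq_iff mem_rotate_triangle_image lower_def upper_def triangle_row_rotate)
qed

theorem M_cut_row_symmetric:
  assumes "finite R" and sym: "rotate_triangle (d, 2 * j) ` R = R"
  shows "M R = (\<Sum>S\<in>Pow (crossing j R).
    M (upper j R - ups j S) * M (upper j R - ups j (mirror d ` S)))"
proof -
  have "lower j R - downs (j - 1) S
      = rotate_triangle (d, 2 * j) ` (upper j R - ups j (mirror d ` S))" for S
  proof -
    have "\<Union>(vertical j ` S) = rotate_triangle (d, 2 * j) ` \<Union>(vertical j ` mirror d ` S)"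
      by (simp only: rotate_vertical mirror_image_image flip: Union_rotate_tiling)
    then have "lower j R - \<Union>(vertical j ` S)
        = rotate_triangle (d, 2 * j) ` (upper j R - \<Union>(vertical j ` mirror d ` S))"
      by (simp only: lower_eq_rotate_upper[OF sym] image_set_diff[OF inj_rotate_triangle])
    then show ?thesis by (simp only: upper_minus_vertical lower_minus_vertical)
  qed
  then show ?thesis by (simp only: M_cut_row[OF assms(1), of j] M_rotate)
qed

theorem M_odot_cut_row:
  assumes "finite R" and sym: "rotate_triangle (d, 2 * j) ` R = R"
  shows "M_odot (d, 2 * j) R
    = (\<Sum>S | S \<subseteq> crossing j R \<and> mirror d ` S = S. M (upper j R - ups j S))"
proof -
  let ?\<S> = "{S. S \<subseteq> crossing j R \<and> mirror d ` S = S}"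
  have vertical_eq: "vertical j ` S = vertical j ` S' \<longleftrightarrow> S = S'" for S S'
    by (rule inj_image_eq_iff[OF inj_vertical])
  have invariant: "rotate_tiling (d, 2 * j) (vertical j ` S) = vertical j ` S
      \<longleftrightarrow> mirror d ` S = S" for S
    by (simp only: rotate_vertical vertical_eq)
  have "M_odot (d, 2 * j) R
      = (\<Sum>C | C \<in> (`) (vertical j) ` Pow (crossing j R) \<and> rotate_tiling (d, 2 * j) C = C.
          M (upper j R - \<Union>C))"
    using M_odot_Un_rotate[of "upper j R" "(d, 2 * j)"] assms(1)
    by (simp add: upper_Un_lower upper_Int_lower straddlings_upper_lower
        flip: lower_eq_rotate_upper[OF sym])
  also have "{C. C \<in> (`) (vertical j) ` Pow (crossing j R) \<and> rotate_tiling (d, 2 * j) C = C}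
      = (`) (vertical j) ` ?\<S>"
    by (simp only: Compr_image_eq invariant Pow_iff)
  also have "(\<Sum>C\<in>(`) (vertical j) ` ?\<S>. M (upper j R - \<Union>C))
      = (\<Sum>S\<in>?\<S>. M (upper j R - \<Union>(vertical j ` S)))"
    by (rule sum.reindex_cong[OF _ refl refl]) (simp add: inj_on_def vertical_eq)
  finally show ?thesis by (simp only: upper_minus_vertical)
qed

section \<open>Rows of triangles\<close>

definition strip_triangle :: "int \<Rightarrow> int \<Rightarrow> unit_triangle" where
  "strip_triangle j m = (if even m then Up (m div 2) j else Down (m div 2) j)"

definition strip :: "int \<Rightarrow> int set \<Rightarrow> region" where
  "strip j A = strip_triangle j ` A"

lemma strip_empty [simp]: "strip j {} = {}"
  by (simp add: strip_def)

lemma strip_triangle_eq_iff: "strip_triangle j m = strip_triangle j n \<longleftrightarrow> m = n"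
  by (cases "even m"; cases "even n"; simp add: strip_triangle_def; presburger)

lemma strip_triangle_in_strip [simp]: "strip_triangle j m \<in> strip j A \<longleftrightarrow> m \<in> A"
  by (auto simp: strip_def strip_triangle_eq_iff)

lemma Up_in_strip: "Up i k \<in> strip j A \<longleftrightarrow> k = j \<and> 2 * i \<in> A"
  and Down_in_strip: "Down i k \<in> strip j A \<longleftrightarrow> k = j \<and> 2 * i + 1 \<in> A"
  unfolding strip_def strip_triangle_def image_iff by (auto elim: evenE oddE intro: rev_bexI)

lemma strip_Diff: "strip j (A - B) = strip j A - strip j B"
  by (auto simp: strip_def strip_triangle_eq_iff)

lemma is_lozenge_strip_triangles:
  "is_lozenge {strip_triangle j m, strip_triangle j n} \<longleftrightarrow> n = m + 1 \<or> n = m - 1"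
  by (cases "even m"; cases "even n")
    (auto simp: strip_triangle_def is_lozenge_Up is_lozenge_Down elim!: evenE oddE, presburger+)

lemma M_strip_least:
  assumes "m \<in> A" and least: "\<And>n. n \<in> A \<Longrightarrow> m \<le> n"
  shows "M (strip j A) = (if m + 1 \<in> A then M (strip j (A - {m, m + 1})) else 0)"
proof -
  have partner: "v = strip_triangle j (m + 1)" "m + 1 \<in> A"
    if "is_lozenge {strip_triangle j m, v}" "v \<in> strip j A" for v
    using that least by (force simp: strip_def is_lozenge_strip_triangles)+
  show ?thesis
  proof (cases "m + 1 \<in> A")
    case True
    have "M (strip j A) = M (strip j A - {strip_triangle j m, strip_triangle j (m + 1)})"
      using True assms(1) partner(1)
      by (intro M_forced_lozenge) (auto simp: is_lozenge_strip_triangles)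
    also have "\<dots> = M (strip j (A - {m, m + 1}))"
      unfolding strip_Diff by (simp add: strip_def)
    finally show ?thesis using True by simp
  next
    case False
    have "M (strip j A) = 0"
      by (rule M_isolated[of "strip_triangle j m"]) (use assms(1) partner(2) False in auto)
    then show ?thesis using False by simp
  qed
qed

lemma M_strip_gap:
  assumes "u \<le> v" "\<And>b. b \<in> B \<Longrightarrow> v < b"
  shows "M (strip j ({u..<v} \<union> B)) = (if even (v - u) then M (strip j B) else 0)"
  using assms(1)
proof (induction "nat (v - u)" arbitrary: u rule: less_induct)
  case less
  consider "u = v" | "v = u + 1" | "u + 2 \<le> v" using less.prems by linarith
  then show ?case
  proof cases
    case 1
    then show ?thesis by simp
  next
    case 2
    then show ?thesis using M_strip_least[of u "{u..<v} \<union> B" j] assms(2) by fastforce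
  next
    case 3
    have "M (strip j ({u..<v} \<union> B)) = M (strip j ({u..<v} \<union> B - {u, u + 1}))"
      using 3 assms(2) by (subst M_strip_least[of u]) fastforce+
    also have "{u..<v} \<union> B - {u, u + 1} = {u + 2..<v} \<union> B"
      using 3 assms(2) by fastforce
    also have "M (strip j \<dots>) = (if even (v - (u + 2)) then M (strip j B) else 0)"
      using 3 by (intro less.hyps) auto
    finally show ?thesis by simp
  qed
qed

lemma M_strip_no_dents:
  assumes "u \<le> v" "{u..<v} \<inter> D = {}"
  shows "M (strip j ({u..<v} - D)) = of_bool (even (v - u))"
  using M_strip_gap[of u v "{}" j] assms by (simp add: Diff_triv)

lemma M_strip_first_dent:
  assumes "u \<le> m" "m < v" "m \<in> D" "\<And>n. n \<in> D \<Longrightarrow> u \<le> n \<Longrightarrow> m \<le> n"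
  shows "M (strip j ({u..<v} - D)) = (if even (m - u) then M (strip j ({m + 1..<v} - D)) else 0)"
proof -
  have "n \<notin> D" if "u \<le> n" "n < m" for n using assms(4)[of n] that by auto
  then have "{u..<v} - D = {u..<m} \<union> ({m + 1..<v} - D)"
    using assms(1-3) by (auto simp: add1_zle_eq order.strict_iff_order)
  then show ?thesis using M_strip_gap[of u m "{m + 1..<v} - D" j] assms(1) by simp
qed

definition row_dents :: "int set \<Rightarrow> int set \<Rightarrow> int set" where
  "row_dents S S' = (\<lambda>i. 2 * i) ` S \<union> (\<lambda>i. 2 * i + 1) ` S'"

definition dented_row :: "int \<Rightarrow> int \<Rightarrow> int \<Rightarrow> int set \<Rightarrow> int set \<Rightarrow> region" where
  "dented_row j p N S S' = strip j ({2 * p..<2 * N - 1} - row_dents S S')"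

lemma M_dented_row_no_dents: "p < N \<Longrightarrow> M (dented_row j p N {} {}) = 0"
  unfolding dented_row_def
  by (subst M_strip_no_dents) (auto simp: row_dents_def)

lemma M_dented_row_one_Up:
  assumes "p \<le> a" "a < N"
  shows "M (dented_row j p N {a} {}) = 1"
proof -
  have "M (dented_row j p N {a} {}) = M (strip j ({2 * a + 1..<2 * N - 1} - row_dents {a} {}))"
    unfolding dented_row_def using assms
    by (subst M_strip_first_dent[of _ "2 * a"]) (auto simp: row_dents_def)
  also have "\<dots> = 1"
    using assms by (subst M_strip_no_dents) (auto simp: row_dents_def)
  finally show ?thesis .
qed

lemma M_dented_row_Down_first:
  assumes "p \<le> t" "t < N - 1" "t \<in> S'" "\<And>i. i \<in> S' \<Longrightarrow> t \<le> i" "\<And>i. i \<in> S \<Longrightarrow> t < i"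
  shows "M (dented_row j p N S S') = 0"
proof -
  have "2 * t + 1 \<le> 2 * i" if "i \<in> S" for i using assms(5)[OF that] by simp
  then show ?thesis
    unfolding dented_row_def using assms(1-4)
    by (subst M_strip_first_dent[of _ "2 * t + 1"]) (auto simp: row_dents_def)
qed

lemma M_dented_row_Up_Up_first:
  assumes "p \<le> a" "a < b" "b < N" "b \<in> S" "\<And>i. i \<in> S \<Longrightarrow> b \<le> i" "\<And>i. i \<in> S' \<Longrightarrow> b \<le> i"
  shows "M (dented_row j p N (insert a S) S') = 0"
proof -
  let ?D = "row_dents (insert a S) S'"
  have D: "2 * a \<in> ?D" "2 * b \<in> ?D" using assms(4) by (auto simp: row_dents_def)
  have later: "n = 2 * a \<or> 2 * b \<le> n" if "n \<in> ?D" for n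
    using that by (auto simp: row_dents_def dest: assms(5) assms(6))
  have "M (dented_row j p N (insert a S) S') = M (strip j ({2 * a + 1..<2 * N - 1} - ?D))"
    unfolding dented_row_def using assms(1-3) D later
    by (subst M_strip_first_dent[of _ "2 * a"]) fastforce+
  also have "\<dots> = 0"
    using assms(2,3) D later by (subst M_strip_first_dent[of _ "2 * b"]) fastforce+
  finally show ?thesis .
qed

lemma M_dented_row_Up_Down_first:
  assumes "p \<le> a" "a \<le> t" "t < N - 1" "\<And>i. i \<in> S \<Longrightarrow> t < i" "\<And>i. i \<in> S' \<Longrightarrow> t < i"
  shows "M (dented_row j p N (insert a S) (insert t S')) = M (dented_row j (t + 1) N S S')"
proof -
  let ?D = "row_dents (insert a S) (insert t S')"
  have S: "2 * t + 1 \<le> 2 * i" "2 * a \<le> 2 * i" if "i \<in> S" for i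
    using assms(2) assms(4)[OF that] by simp_all
  have S': "2 * t + 1 \<le> 2 * i + 1" "2 * a \<le> 2 * i + 1" if "i \<in> S'" for i
    using assms(2) assms(5)[OF that] by simp_all
  have "M (dented_row j p N (insert a S) (insert t S'))
      = M (strip j ({2 * a + 1..<2 * N - 1} - ?D))"
    unfolding dented_row_def using assms(1-3) S S'
    by (subst M_strip_first_dent[of _ "2 * a"]) (auto simp: row_dents_def)
  also have "\<dots> = M (strip j ({2 * t + 1 + 1..<2 * N - 1} - ?D))"
    using assms(2,3) S S' by (subst M_strip_first_dent[of _ "2 * t + 1"]) (auto simp: row_dents_def)
  also have "{2 * t + 1 + 1..<2 * N - 1} - ?D = {2 * (t + 1)..<2 * N - 1} - row_dents S S'"
    using assms(2) by (auto simp: row_dents_def)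
  finally show ?thesis by (simp only: dented_row_def)
qed

lemma M_dented_row:
  assumes "sorted_wrt (<) xs" "sorted_wrt (<) ts" "set xs \<subseteq> {p..<N}" "set ts \<subseteq> {p..<N - 1}" "p < N"
  shows "M (dented_row j p N (set xs) (set ts)) = of_bool (interlaces xs ts)"
  using assms
proof (induction ts arbitrary: p xs)
  case Nil
  consider "xs = []" | a where "xs = [a]" | a b xs' where "xs = a # b # xs'"
    by (cases xs rule: remdups_adj.cases)
  then show ?case
  proof cases
    case (3 a b xs')
    then show ?thesis
      using Nil.prems M_dented_row_Up_Up_first[of p a b N "set (b # xs')" "{}" j] by force
  qed (use Nil.prems M_dented_row_no_dents M_dented_row_one_Up in auto)
next
  case (Cons t ts)
  have t: "p \<le> t" "t < N - 1" and ts: "\<And>u. u \<in> set ts \<Longrightarrow> t < u" using Cons.prems by auto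
  consider "xs = [] \<or> t < hd xs" | a b xs' where "xs = a # b # xs'" "b \<le> t"
    | a xs' where "xs = a # xs'" "a \<le> t" "xs' = [] \<or> t < hd xs'"
    by (cases xs rule: remdups_adj.cases) fastforce+
  then show ?case
  proof cases
    case 1
    have "t < i" if "i \<in> set xs" for i
      using 1 that Cons.prems(1) by (cases xs) auto
    then have "M (dented_row j p N (set xs) (set (t # ts))) = 0"
      using t ts by (intro M_dented_row_Down_first[of p t]) (auto simp: less_imp_le)
    moreover have "\<not> interlaces xs (t # ts)"
      using 1 by (cases "(xs, t # ts)" rule: interlaces.cases) auto
    ultimately show ?thesis by simp
  next
    case (2 a b xs')
    then have "M (dented_row j p N (set xs) (set (t # ts))) = 0"
      using Cons.prems M_dented_row_Up_Up_first[of p a b N "set (b # xs')" "set (t # ts)" j]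
      by force
    then show ?thesis using 2 by simp
  next
    case (3 a xs')
    have later: "t < i" if "i \<in> set xs'" for i
      using 3(3) that Cons.prems(1) by (cases xs') (auto simp: 3(1))
    have "M (dented_row j p N (set xs) (set (t # ts)))
        = M (dented_row j (t + 1) N (set xs') (set ts))"
      using 3(1,2) t ts later Cons.prems(3) by (simp add: M_dented_row_Up_Down_first)
    also have "\<dots> = of_bool (interlaces xs' ts)"
      using 3(1) t ts later Cons.prems by (intro Cons.IH) force+
    finally show ?thesis using 3 by (cases xs') simp_all
  qed
qed

section \<open>Trapezoids with dents\<close>

definition trapezoid :: "int \<Rightarrow> int \<Rightarrow> nat \<Rightarrow> region" where
  "trapezoid j N n = region_of {(i, k). j \<le> k \<and> k \<le> j + int n \<and> 0 \<le> i \<and> i + k \<le> j + N}"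

lemma mem_trapezoid:
  "Up i k \<in> trapezoid j N n \<longleftrightarrow> j \<le> k \<and> k < j + int n \<and> 0 \<le> i \<and> i + k < j + N"
  "Down i k \<in> trapezoid j N n \<longleftrightarrow> j \<le> k \<and> k < j + int n \<and> 0 \<le> i \<and> i + k + 1 < j + N"
  by (auto simp: trapezoid_def Up_in_region_of Down_in_region_of)

lemma finite_trapezoid: "finite (trapezoid j N n)"
  unfolding trapezoid_def
proof (rule finite_region_of, rule finite_subset)
  show "{(i, k). j \<le> k \<and> k \<le> j + int n \<and> 0 \<le> i \<and> i + k \<le> j + N} \<subseteq> {0..N} \<times> {j..j + int n}"
    by auto
qed simp

lemma trapezoid_0: "trapezoid j N 0 = {}"
  by (rule region_eqI) (auto simp: mem_trapezoid)

lemma M_trapezoid_Suc: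
  assumes xs: "sorted_wrt (<) xs" "set xs \<subseteq> {0..<N}" and N: "0 < N"
  shows "M (trapezoid j N (Suc n) - ups j (set xs))
    = (\<Sum>S\<in>Pow (if n = 0 then {} else {0..<N - 1}).
         M (trapezoid (j + 1) (N - 1) n - ups (j + 1) S)
         * of_bool (interlaces xs (sorted_list_of_set S)))"
proof -
  let ?R = "trapezoid j N (Suc n) - ups j (set xs)"
  have upper: "upper (j + 1) ?R = trapezoid (j + 1) (N - 1) n"
    by (rule region_eqI) (auto simp: upper_def mem_trapezoid)
  have lower: "lower (j + 1) ?R - downs j S = dented_row j 0 N (set xs) S" for S
  proof (rule region_eqI)
    fix i k
    show "Up i k \<in> lower (j + 1) ?R - downs j S \<longleftrightarrow> Up i k \<in> dented_row j 0 N (set xs) S"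
      by (auto simp: lower_def mem_trapezoid Up_in_strip dented_row_def row_dents_def) presburger+
    show "Down i k \<in> lower (j + 1) ?R - downs j S \<longleftrightarrow> Down i k \<in> dented_row j 0 N (set xs) S"
      by (auto simp: lower_def mem_trapezoid Down_in_strip dented_row_def row_dents_def) presburger+
  qed
  have crossing: "crossing (j + 1) ?R = (if n = 0 then {} else {0..<N - 1})"
    by (auto simp: crossing_def mem_trapezoid)
  have row: "M (dented_row j 0 N (set xs) S) = of_bool (interlaces xs (sorted_list_of_set S))"
    if "S \<in> Pow (if n = 0 then {} else {0..<N - 1})" for S
  proof -
    have S: "S \<subseteq> {0..<N - 1}" using that by (auto split: if_splits)
    then have "finite S" by (rule finite_subset) simp
    then show ?thesis using M_dented_row[of xs "sorted_list_of_set S" 0 N j] xs S N by simp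
  qed
  have "M ?R = (\<Sum>S\<in>Pow (if n = 0 then {} else {0..<N - 1}).
      M (trapezoid (j + 1) (N - 1) n - ups (j + 1) S) * M (dented_row j 0 N (set xs) S))"
    using M_cut_row[of ?R "j + 1"] by (simp add: upper lower crossing finite_trapezoid)
  also have "\<dots> = (\<Sum>S\<in>Pow (if n = 0 then {} else {0..<N - 1}).
         M (trapezoid (j + 1) (N - 1) n - ups (j + 1) S)
         * of_bool (interlaces xs (sorted_list_of_set S)))"
    by (intro sum.cong refl) (simp only: row)
  finally show ?thesis .
qed

lemma sum_interlaces:
  fixes f :: "int set \<Rightarrow> 'a :: semiring_1"
  assumes xs: "sorted_wrt (<) xs" "set xs \<subseteq> {0..<N}"
  shows "(\<Sum>S\<in>Pow {0..<N - 1}. f S * of_bool (interlaces xs (sorted_list_of_set S)))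
       = (\<Sum>ts | interlaces xs ts. f (set ts))"
proof -
  let ?B = "{S \<in> Pow {0..<N - 1}. interlaces xs (sorted_list_of_set S)}"
  have "(\<Sum>S\<in>Pow {0..<N - 1}. f S * of_bool (interlaces xs (sorted_list_of_set S)))
      = (\<Sum>S\<in>?B. f S)"
    by (intro sum.mono_neutral_cong_right) auto
  also have "\<dots> = (\<Sum>ts | interlaces xs ts. f (set ts))"
  proof (rule sum.reindex_bij_witness[where j = sorted_list_of_set and i = set])
    fix ts assume ts: "ts \<in> {ts. interlaces xs ts}"
    have sorted: "sorted_wrt (<) ts" using interlaces_strict_sorted ts xs by auto
    then show eq: "sorted_list_of_set (set ts) = ts"
      by (simp add: strict_sorted_iff sorted_list_of_set.idem_if_sorted_distinct)
    have "xs \<noteq> []" using ts by (cases xs) auto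
    then have "hd xs \<in> set xs" "last xs \<in> set xs" by auto
    moreover have "hd xs \<le> t \<and> t < last xs" if "t \<in> set ts" for t
      using interlaces_bounds[of xs ts t] ts xs that by auto
    ultimately have "set ts \<subseteq> {0..<N - 1}" using xs(2) by fastforce
    then show "set ts \<in> ?B" using ts eq by auto
  next
    fix S assume "S \<in> ?B"
    then have "finite S" by (auto intro: finite_subset)
    then show "set (sorted_list_of_set S) = S" "f (set (sorted_list_of_set S)) = f S" by auto
  qed auto
  finally show ?thesis .
qed

definition binomial_det :: "int set \<Rightarrow> real" where
  "binomial_det S = det_of_rows (map binomial_row (sorted_list_of_set S))"

lemma binomial_det_set:
  "sorted_wrt (<) xs \<Longrightarrow> binomial_det (set xs) = det_of_rows (map binomial_row xs)"
  by (simp add: binomial_det_def strict_sorted_iff sorted_list_of_set.idem_if_sorted_distinct)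

lemma binomial_det_eq_vandermonde:
  "finite S \<Longrightarrow> binomial_det S = vandermonde S / real (h (card S))"
  using vandermonde_strict_sorted[of "sorted_list_of_set S"]
  by (simp add: binomial_det_def det_binomial_rows h_def)

lemma sum_binomial_det_interlaces:
  assumes xs: "sorted_wrt (<) xs" "set xs \<subseteq> {0..<N}"
  shows "(\<Sum>S\<in>Pow {0..<N - 1}. of_bool (card S = n) * binomial_det S
            * of_bool (interlaces xs (sorted_list_of_set S)))
       = of_bool (length xs = Suc n) * binomial_det (set xs)"
proof -
  have "of_bool (card (set ts) = n) * binomial_det (set ts)
      = of_bool (length xs = Suc n) * det_of_rows (map binomial_row ts)"
    if "interlaces xs ts" for ts
  proof -
    have "sorted_wrt (<) ts" "length xs = Suc (length ts)"
      using interlaces_strict_sorted interlaces_length that xs(1) by auto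
    then show ?thesis by (simp add: binomial_det_set distinct_card strict_sorted_iff)
  qed
  then have "(\<Sum>S\<in>Pow {0..<N - 1}. of_bool (card S = n) * binomial_det S
            * of_bool (interlaces xs (sorted_list_of_set S)))
      = (\<Sum>ts | interlaces xs ts. of_bool (length xs = Suc n) * det_of_rows (map binomial_row ts))"
    unfolding sum_interlaces[OF xs, of "\<lambda>S. of_bool (card S = n) * binomial_det S"]
    by (intro sum.cong) simp_all
  also have "\<dots> = of_bool (length xs = Suc n) * binomial_det (set xs)"
    using sum_det_binomial_rows_interlaces[of xs] xs(1)
    by (cases "xs = []") (auto simp: strict_sorted_iff binomial_det_set simp flip: sum_distrib_left)
  finally show ?thesis .
qed

lemma M_trapezoid_eq_binomial_det:
  "S \<subseteq> (if n = 0 then {} else {0..<N}) \<Longrightarrow> int n \<le> N \<Longrightarrow>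
   real (M (trapezoid j N n - ups j S)) = of_bool (card S = n) * binomial_det S"
proof (induction n arbitrary: j N S)
  case 0
  then show ?case by (simp add: trapezoid_0 binomial_det_eq_vandermonde)
next
  case (Suc n)
  let ?xs = "sorted_list_of_set S" and ?base = "if n = 0 then {} else {0..<N - 1}"
  have S: "S \<subseteq> {0..<N}" "finite S" and N: "0 < N" "int n \<le> N - 1"
    using Suc.prems finite_subset[of S "{0..<N}"] by auto
  have xs: "sorted_wrt (<) ?xs" "set ?xs = S" using S(2) by auto
  have "real (M (trapezoid j N (Suc n) - ups j S))
      = (\<Sum>S'\<in>Pow ?base. of_bool (card S' = n) * binomial_det S'
          * of_bool (interlaces ?xs (sorted_list_of_set S')))"
    using M_trapezoid_Suc[OF xs(1) _ N(1), of j n] S xs Suc.IH[OF _ N(2), of _ "j + 1"]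
    by (auto intro!: sum.cong)
  also have "\<dots> = (\<Sum>S'\<in>Pow {0..<N - 1}. of_bool (card S' = n) * binomial_det S'
          * of_bool (interlaces ?xs (sorted_list_of_set S')))"
  proof (rule sum.mono_neutral_left)
    show "\<forall>S'\<in>Pow {0..<N - 1} - Pow ?base. of_bool (card S' = n) * binomial_det S'
          * of_bool (interlaces ?xs (sorted_list_of_set S')) = 0"
      by (auto dest: finite_subset)
  qed auto
  also have "\<dots> = of_bool (card S = Suc n) * binomial_det S"
    using sum_binomial_det_interlaces[of ?xs N n] xs S by simp
  finally show ?case .
qed

text \<open>The formula of Cohn, Larsen and Propp.\<close>

theorem M_trapezoid:
  assumes "S \<subseteq> (if n = 0 then {} else {0..<N})" "int n \<le> N"
  shows "real (M (trapezoid j N n - ups j S))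
    = (if card S = n then vandermonde S / real (h n) else 0)"
proof -
  have "finite S" using assms(1) by (rule finite_subset) simp
  then show ?thesis
    using M_trapezoid_eq_binomial_det[OF assms] by (simp add: binomial_det_eq_vandermonde)
qed

section \<open>Triangles standing on a horizontal line\<close>

definition standing :: "int \<Rightarrow> region \<Rightarrow> bool" where
  "standing j \<Delta> \<longleftrightarrow> (\<forall>i k. Up i k \<in> \<Delta> \<longrightarrow> k = j \<or> j < k \<and> Down i (k - 1) \<in> \<Delta>)
     \<and> (\<forall>i k. Down i k \<in> \<Delta> \<longrightarrow> j \<le> k \<and> {Up i k, Up (i + 1) k, Up i (k + 1)} \<subseteq> \<Delta>)"

lemma standing_Un: "standing j \<Delta> \<Longrightarrow> standing j \<Delta>' \<Longrightarrow> standing j (\<Delta> \<union> \<Delta>')"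
  by (auto simp: standing_def)

lemma standing_UN: "(\<And>i. i \<in> I \<Longrightarrow> standing j (\<Delta> i)) \<Longrightarrow> standing j (\<Union>i\<in>I. \<Delta> i)"
  unfolding standing_def by fast

lemma standing_up_triangle: "standing q (up_triangle (p, q) b)"
  by (auto simp: standing_def mem_up_triangle)

text \<open>Removing the bottom row of \<open>\<Delta>\<close> forces, row by row, the vertical lozenges that fill the rest.\<close>

lemma standing_vertical_forced:
  assumes \<Delta>: "standing j \<Delta>" "\<Delta> \<subseteq> R"
    and T: "T \<in> tilings (R - ups j {i. Up i j \<in> \<Delta>})" and "Down i k \<in> \<Delta>"
  shows "{Down i k, Up i (k + 1)} \<in> T"
  using \<open>Down i k \<in> \<Delta>\<close>
proof (induction "nat (k - j)" arbitrary: i k rule: less_induct)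
  case less
  have "Down i k \<in> R - ups j {i. Up i j \<in> \<Delta>}" using less.prems \<Delta>(2) by auto
  then obtain u where u: "{Down i k, u} \<in> T" "is_lozenge {Down i k, u}"
      "u \<in> R - ups j {i. Up i j \<in> \<Delta>}"
    by (rule tiling_lozengeE[OF T])
  have "u \<noteq> Up i' k" if "i' \<in> {i, i + 1}" for i'
  proof
    assume eq: "u = Up i' k"
    have "Up i' k \<in> \<Delta>" using \<Delta>(1) less.prems that unfolding standing_def by blast
    moreover have "k \<noteq> j" using u(3) calculation eq by auto
    ultimately have below: "j < k" "Down i' (k - 1) \<in> \<Delta>"
      using \<Delta>(1) unfolding standing_def by blast+
    then have "{Down i' (k - 1), Up i' (k - 1 + 1)} \<in> T" by (intro less.hyps) auto
    then have "{Down i' (k - 1), Up i' k} \<inter> {Down i k, u} = {}"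
      by (intro tilingsD(2)[OF T _ u(1)]) (auto simp: doubleton_eq_iff)
    then show False using eq by simp
  qed
  then have "u = Up i (k + 1)" using u(2) by (auto simp: is_lozenge_Down)
  then show ?case using u(1) by simp
qed

theorem M_Diff_standing:
  assumes \<Delta>: "standing j \<Delta>" "\<Delta> \<subseteq> R"
  shows "M (R - \<Delta>) = M (R - ups j {i. Up i j \<in> \<Delta>})"
proof -
  let ?R = "R - ups j {i. Up i j \<in> \<Delta>}"
  let ?P = "(\<lambda>(i, k). {Down i k, Up i (k + 1)}) ` {(i, k). Down i k \<in> \<Delta>}"
  have above: "j \<le> k \<and> Up i (k + 1) \<in> \<Delta>" if "Down i k \<in> \<Delta>" for i k
    using \<Delta>(1) that unfolding standing_def by blast
  have Up_mem: "Up i k \<in> \<Union>?P \<longleftrightarrow> Down i (k - 1) \<in> \<Delta>" and Down_mem: "Down i k \<in> \<Union>?P \<longleftrightarrow> Down i k \<in> \<Delta>"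
    for i k by force+
  have "?P \<in> tilings (\<Union>?P)"
    by (rule tilingsI) (auto simp: is_lozenge_Down doubleton_eq_iff)
  moreover have "\<Union>?P \<subseteq> ?R" using above \<Delta>(2) by fastforce
  moreover have "?P \<subseteq> T" if "T \<in> tilings ?R" for T
    using standing_vertical_forced[OF \<Delta> that] by auto
  ultimately have "M ?R = M (?R - \<Union>?P)" by (intro M_forced)
  also have "?R - \<Union>?P = R - \<Delta>"
  proof (rule region_eqI)
    fix i k
    have "Up i k \<in> \<Delta> \<longleftrightarrow> k = j \<and> Up i j \<in> \<Delta> \<or> Down i (k - 1) \<in> \<Delta>"
      using \<Delta>(1) above[of i "k - 1"] unfolding standing_def by auto
    then show "Up i k \<in> ?R - \<Union>?P \<longleftrightarrow> Up i k \<in> R - \<Delta>"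
      unfolding Diff_iff Up_mem Up_in_ups by blast
    show "Down i k \<in> ?R - \<Union>?P \<longleftrightarrow> Down i k \<in> R - \<Delta>"
      unfolding Diff_iff Down_mem by simp
  qed
  finally show ?thesis by simp
qed

section \<open>Ferns\<close>

abbreviation prefix_sum :: "nat list \<Rightarrow> nat \<Rightarrow> nat" where
  "prefix_sum bs i \<equiv> sum_list (take i bs)"

lemma prefix_sum_mono: "i \<le> j \<Longrightarrow> prefix_sum bs i \<le> prefix_sum bs j"
  using take_add[of i "j - i" bs] by simp

lemma prefix_sum_Suc: "i < length bs \<Longrightarrow> prefix_sum bs (Suc i) = prefix_sum bs i + bs ! i"
  by (simp add: take_Suc_conv_app_nth)

lemma prefix_sum_le: "prefix_sum bs i \<le> sum_list bs"
  using sum_list_append[of "take i bs" "drop i bs"] by simp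

lemma prefix_sum_palindrome:
  assumes "rev bs = bs"
  shows "prefix_sum bs (length bs - i) + prefix_sum bs i = sum_list bs"
proof -
  have "take (length bs - i) bs = rev (drop i bs)"
    by (metis assms rev_drop rev_rev_ident)
  then show ?thesis
    using sum_list_append[of "take i bs" "drop i bs"] by (simp add: add.commute)
qed

lemma sum_nth_eq_prefix_sum_diff:
  "i \<le> j \<Longrightarrow> j < length bs \<Longrightarrow> (\<Sum>t = i..j. bs ! t) = prefix_sum bs (Suc j) - prefix_sum bs i"
proof (induction j rule: dec_induct)
  case base
  then show ?case by (simp add: prefix_sum_Suc)
next
  case (step j)
  have "prefix_sum bs i \<le> prefix_sum bs (Suc j)" using step by (intro prefix_sum_mono) auto
  then show ?case using step by (simp add: prefix_sum_Suc)
qed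

definition lobe :: "int \<Rightarrow> nat list \<Rightarrow> nat \<Rightarrow> int set" where
  "lobe p bs i = {p + int (prefix_sum bs i)..<p + int (prefix_sum bs (Suc i))}"

definition up_lobes :: "int \<Rightarrow> nat list \<Rightarrow> int set" where
  "up_lobes p bs = (\<Union>i\<in>{i. i < length bs \<and> even i}. lobe p bs i)"

definition down_lobes :: "int \<Rightarrow> nat list \<Rightarrow> int set" where
  "down_lobes p bs = (\<Union>i\<in>{i. i < length bs \<and> odd i}. lobe p bs i)"

lemma finite_lobe [simp]: "finite (lobe p bs i)"
  by (simp add: lobe_def)

lemma finite_up_lobes [simp]: "finite (up_lobes p bs)"
  and finite_down_lobes [simp]: "finite (down_lobes p bs)"
  by (simp_all add: up_lobes_def down_lobes_def)

lemma disjoint_family_lobe: "disjoint_family_on (lobe p bs) I"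
proof -
  have "lobe p bs i \<inter> lobe p bs j = {}" if "i < j" for i j
    using prefix_sum_mono[of "Suc i" j bs] that by (auto simp: lobe_def)
  then show ?thesis
    unfolding disjoint_family_on_def by (metis Int_commute linorder_neqE_nat)
qed

lemma UN_lobe: "(\<Union>i<n. lobe p bs i) = {p..<p + int (prefix_sum bs n)}"
proof (induction n)
  case (Suc n)
  then show ?case
    using prefix_sum_mono[of n "Suc n" bs] by (auto simp: lessThan_Suc lobe_def)
qed simp

lemma up_lobes_Un_down_lobes: "up_lobes p bs \<union> down_lobes p bs = {p..<p + int (sum_list bs)}"
proof -
  have "up_lobes p bs \<union> down_lobes p bs = (\<Union>i<length bs. lobe p bs i)"
    unfolding up_lobes_def down_lobes_def by blast
  then show ?thesis by (simp add: UN_lobe)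
qed

lemma up_lobes_Int_down_lobes: "up_lobes p bs \<inter> down_lobes p bs = {}"
proof -
  have "lobe p bs i \<inter> lobe p bs j = {}" if "even i" "odd j" for i j
    using disjoint_family_onD[OF disjoint_family_lobe[of p bs UNIV], of i j] that by auto
  then show ?thesis unfolding up_lobes_def down_lobes_def by fast
qed

lemma card_up_lobes: "card (up_lobes p bs) = odd_sum bs"
proof -
  have "card (up_lobes p bs) = (\<Sum>i | i < length bs \<and> even i. card (lobe p bs i))"
    unfolding up_lobes_def using disjoint_family_lobe[of p bs]
    by (intro card_UN_disjoint) (auto simp: disjoint_family_on_def)
  also have "\<dots> = odd_sum bs"
    unfolding odd_sum_def by (intro sum.cong) (auto simp: lobe_def prefix_sum_Suc)
  finally show ?thesis .
qed

lemma mirror_lobe: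
  assumes "rev bs = bs" "i < length bs"
  shows "mirror (2 * p + int (sum_list bs)) ` lobe p bs i = lobe p bs (length bs - Suc i)"
proof -
  have "Suc (length bs - Suc i) = length bs - i" using assms(2) by simp
  then show ?thesis
    using prefix_sum_palindrome[OF assms(1), of i] prefix_sum_palindrome[OF assms(1), of "Suc i"]
    by (auto simp: lobe_def mem_mirror_image mirror_def)
qed

lemma mirror_up_lobes:
  assumes bs: "rev bs = bs" "even (length bs)"
  shows "mirror (2 * p + int (sum_list bs)) ` up_lobes p bs = down_lobes p bs"
proof -
  let ?r = "\<lambda>i. length bs - Suc i"
  have "{i. i < length bs \<and> odd i} = ?r ` {i. i < length bs \<and> even i}"
    using bs(2) by (intro equalityI subsetI, intro rev_image_eqI[of "?r _"]) auto
  then have "down_lobes p bs = (\<Union>i\<in>{i. i < length bs \<and> even i}. lobe p bs (?r i))"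
    by (simp add: down_lobes_def)
  also have "\<dots> = mirror (2 * p + int (sum_list bs)) ` up_lobes p bs"
    by (simp add: up_lobes_def image_UN mirror_lobe[OF bs(1)])
  finally show ?thesis ..
qed

lemma odd_sum_palindrome:
  assumes "rev bs = bs" "even (length bs)"
  shows "2 * odd_sum bs = sum_list bs"
proof -
  have "card (down_lobes 0 bs) = odd_sum bs"
    by (simp add: card_image inj_mirror card_up_lobes flip: mirror_up_lobes[OF assms])
  then have "card (up_lobes 0 bs \<union> down_lobes 0 bs) = 2 * odd_sum bs"
    by (simp add: card_Un_disjoint up_lobes_Int_down_lobes card_up_lobes)
  then show ?thesis by (simp add: up_lobes_Un_down_lobes)
qed

lemma rotate_triangle_mem_triangle_iff:
  "rotate_triangle (d, 2 * q) t \<in> up_triangle (p, q) b \<longleftrightarrow> t \<in> down_triangle (d - p - int b, q) b"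
  "rotate_triangle (d, 2 * q) t \<in> down_triangle (p, q) b \<longleftrightarrow> t \<in> up_triangle (d - p - int b, q) b"
  by (cases t; auto simp: mem_up_triangle mem_down_triangle)+

lemma mem_fern:
  "t \<in> fern (p, q) bs \<longleftrightarrow> (\<exists>i<length bs.
     if even i then t \<in> up_triangle (p + int (prefix_sum bs i), q) (bs ! i)
     else t \<in> down_triangle (p + int (prefix_sum bs i), q) (bs ! i))"
  by (auto simp: fern_def Let_def)

lemma rotate_fern:
  assumes bs: "rev bs = bs" "even (length bs)"
  shows "rotate_triangle (2 * p + int (sum_list bs), 2 * q) ` fern (p, q) bs = fern (p, q) bs"
proof (rule rotate_triangle_image_eqI)
  let ?d = "2 * p + int (sum_list bs)"
  fix t assume "t \<in> fern (p, q) bs"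
  then obtain i where i: "i < length bs"
     "if even i then t \<in> up_triangle (p + int (prefix_sum bs i), q) (bs ! i)
      else t \<in> down_triangle (p + int (prefix_sum bs i), q) (bs ! i)"
    using mem_fern by blast
  define i' where "i' = length bs - Suc i"
  have i': "i' < length bs" "even i' \<longleftrightarrow> odd i" using i(1) bs(2) by (auto simp: i'_def)
  have nth: "bs ! i' = bs ! i"
    using rev_nth[of i' bs] bs(1) i(1) i'(1) by (simp add: i'_def)
  have base: "?d - (p + int (prefix_sum bs i')) - int (bs ! i') = p + int (prefix_sum bs i)"
    using prefix_sum_palindrome[OF bs(1), of "Suc i"] i(1) nth by (simp add: prefix_sum_Suc i'_def)
  have "if even i' then rotate_triangle (?d, 2 * q) t
        \<in> up_triangle (p + int (prefix_sum bs i'), q) (bs ! i')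
      else rotate_triangle (?d, 2 * q) t
        \<in> down_triangle (p + int (prefix_sum bs i'), q) (bs ! i')"
    using i(2) i'(2) unfolding rotate_triangle_mem_triangle_iff base unfolding nth by presburger
  then show "rotate_triangle (?d, 2 * q) t \<in> fern (p, q) bs" using i'(1) mem_fern by blast
qed

lemma upper_fern:
  "upper q (fern (p, q) bs)
     = (\<Union>i\<in>{i. i < length bs \<and> even i}. up_triangle (p + int (prefix_sum bs i), q) (bs ! i))"
proof -
  have "t \<notin> down_triangle (p', q) b" if "q \<le> triangle_row t" for p' b t
    using that by (cases t) (auto simp: mem_down_triangle)
  moreover have "q \<le> triangle_row t" if "t \<in> up_triangle (p', q) b" for p' b t
    using that by (cases t) (auto simp: mem_up_triangle)
  ultimately show ?thesis by (auto simp: upper_def mem_fern)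
qed

lemma standing_upper_fern: "standing q (upper q (fern (p, q) bs))"
  unfolding upper_fern by (intro standing_UN standing_up_triangle)

lemma Up_in_upper_fern: "Up i q \<in> upper q (fern (p, q) bs) \<longleftrightarrow> i \<in> up_lobes p bs"
  by (auto simp: upper_fern mem_up_triangle up_lobes_def lobe_def prefix_sum_Suc)

section \<open>The product formula for the lobes of a fern\<close>

definition gap_factor :: "(nat \<Rightarrow> int) \<Rightarrow> nat \<Rightarrow> nat \<Rightarrow> real" where
  "gap_factor c p q = (if odd (q - p) then h_dist (c p) (c q) else inverse (h_dist (c p) (c q)))"

lemma prod_lessThan_double:
  fixes f :: "nat \<Rightarrow> 'a :: comm_monoid_mult"
  shows "(\<Prod>p<2 * m. f p) = (\<Prod>l<m. f (2 * l) * f (2 * l + 1))"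
  by (induction m) (simp_all add: mult_ac)

lemma vandermonde_alternate_intervals:
  fixes c :: "nat \<Rightarrow> int"
  assumes "mono c"
  shows "vandermonde (\<Union>l<m. {c (2 * l)..<c (2 * l + 1)}) = (\<Prod>q<2 * m. \<Prod>p<q. gap_factor c p q)"
proof (induction m)
  case (Suc m)
  let ?I = "\<lambda>l. {c (2 * l)..<c (2 * l + 1)}"
  let ?U = "\<Union>l<m. ?I l"
  have le: "c i \<le> c j" if "i \<le> j" for i j using monoD[OF assms that] .
  have disj: "?I l \<inter> ?I l' = {}" if "l < l'" for l l'
    using le[of "2 * l + 1" "2 * l'"] that by auto
  have disj_U: "?U \<inter> ?I m = {}" using disj[of _ m] by blast
  have "dist_prod ?U (?I m) = (\<Prod>l<m. dist_prod (?I l) (?I m))"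
    by (rule dist_prod_UN_left) (use disj in \<open>auto simp: disjoint_family_on_def neq_iff\<close>)
  also have "\<dots> = (\<Prod>l<m. gap_factor c (2 * l) (2 * m) * gap_factor c (2 * l + 1) (2 * m)
      * (gap_factor c (2 * l) (2 * m + 1) * gap_factor c (2 * l + 1) (2 * m + 1)))"
  proof (rule prod.cong [OF refl])
    fix l assume "l \<in> {..<m}"
    then show "dist_prod (?I l) (?I m)
      = gap_factor c (2 * l) (2 * m) * gap_factor c (2 * l + 1) (2 * m)
        * (gap_factor c (2 * l) (2 * m + 1) * gap_factor c (2 * l + 1) (2 * m + 1))"
      by (subst dist_prod_intervals) (auto simp: gap_factor_def le field_simps)
  qed
  also have "\<dots> = (\<Prod>p<2 * m. gap_factor c p (2 * m)) * (\<Prod>p<2 * m. gap_factor c p (2 * m + 1))"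
    by (simp add: prod_lessThan_double prod.distrib)
  finally have "vandermonde (?U \<union> ?I m) = (\<Prod>q<2 * m. \<Prod>p<q. gap_factor c p q)
      * h_dist (c (2 * m)) (c (2 * m + 1))
      * ((\<Prod>p<2 * m. gap_factor c p (2 * m)) * (\<Prod>p<2 * m. gap_factor c p (2 * m + 1)))"
    using disj_U Suc.IH le[of "2 * m" "2 * m + 1"]
    by (subst vandermonde_Un) (simp_all add: vandermonde_atLeastLessThan h_dist_def)
  also have "?U \<union> ?I m = (\<Union>l<Suc m. ?I l)" by (auto simp: lessThan_Suc)
  finally show ?case by (simp add: gap_factor_def mult_ac)
qed simp

lemma s_odd_eq_prod_gap_factor:
  "s_odd bs * real (h (odd_sum bs))
     = (\<Prod>q<Suc (length bs). \<Prod>p<q. gap_factor (\<lambda>i. int (prefix_sum bs i)) p q)"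
proof -
  define c where "c i = int (prefix_sum bs i)" for i
  define f where "f = (\<lambda>(i, j). gap_factor c i (Suc j))"
  let ?pairs = "\<lambda>P. {(i, j). i \<le> j \<and> j < length bs \<and> P (j - i + 1)}"
  let ?g = "\<lambda>(i, j). real (h (\<Sum>t = i..j. bs ! t))"
  have fin: "finite (?pairs P)" for P
    by (rule finite_subset[of _ "{..<length bs} \<times> {..<length bs}"]) auto
  have f: "f (i, j) = (if odd (j - i + 1) then ?g (i, j) else inverse (?g (i, j)))"
    if "i \<le> j" "j < length bs" for i j
    using that prefix_sum_mono[of i "Suc j" bs] sum_nth_eq_prefix_sum_diff[OF that]
    by (simp add: f_def c_def gap_factor_def h_dist_def Suc_diff_le nat_diff_distrib'
        of_nat_diff [symmetric] del: of_nat_diff)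
  have "s_odd bs * real (h (odd_sum bs)) = prod ?g (?pairs odd) * inverse (prod ?g (?pairs even))"
    by (simp add: s_odd_def divide_inverse)
  also have "prod ?g (?pairs odd) = prod f (?pairs odd)"
    by (rule prod.cong) (auto simp: f)
  also have "inverse (prod ?g (?pairs even)) = prod f (?pairs even)"
    unfolding prod_inversef[symmetric] by (rule prod.cong) (auto simp: f)
  also have "prod f (?pairs odd) * prod f (?pairs even) = prod f (?pairs odd \<union> ?pairs even)"
    by (rule prod.union_disjoint [symmetric, OF fin fin]) auto
  also have "?pairs odd \<union> ?pairs even = ?pairs (\<lambda>_. True)" by auto
  also have "prod f \<dots> = (\<Prod>(q, p)\<in>(SIGMA q:{..<Suc (length bs)}. {..<q}). gap_factor c p q)"
    by (rule prod.reindex_bij_witness[where i = "\<lambda>(q, p). (p, q - 1)"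
          and j = "\<lambda>(i, j). (Suc j, i)"])
      (auto simp: f_def)
  also have "\<dots> = (\<Prod>q<Suc (length bs). \<Prod>p<q. gap_factor c p q)"
    by (rule prod.Sigma [symmetric]) auto
  finally show ?thesis unfolding c_def .
qed

lemma up_lobes_eq_UN_double: "up_lobes p bs = (\<Union>l<Suc (length bs) div 2. lobe p bs (2 * l))"
proof -
  have "{i. i < length bs \<and> even i} = (\<lambda>l. 2 * l) ` {..<Suc (length bs) div 2}"
    by (auto elim!: evenE)
  then show ?thesis by (simp add: up_lobes_def)
qed

lemma vandermonde_up_lobes_odd_length:
  assumes "odd (length bs)"
  shows "vandermonde (up_lobes p bs) = s_odd bs * real (h (odd_sum bs))"
proof -
  define c where "c i = p + int (prefix_sum bs i)" for i
  have "mono c" by (rule monoI) (simp add: c_def prefix_sum_mono)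
  have "vandermonde (up_lobes p bs)
      = vandermonde (\<Union>l<Suc (length bs) div 2. {c (2 * l)..<c (2 * l + 1)})"
    by (simp add: up_lobes_eq_UN_double lobe_def c_def)
  also have "\<dots> = (\<Prod>q<Suc (length bs). \<Prod>p<q. gap_factor c p q)"
    using vandermonde_alternate_intervals[OF \<open>mono c\<close>] assms by simp
  also have "gap_factor c = gap_factor (\<lambda>i. int (prefix_sum bs i))"
    by (simp add: fun_eq_iff gap_factor_def h_dist_def c_def)
  finally show ?thesis by (simp only: s_odd_eq_prod_gap_factor)
qed

lemma up_lobes_butlast:
  assumes "even (length bs)"
  shows "up_lobes p (butlast bs) = up_lobes p bs"
proof -
  have "i < length bs - 1 \<longleftrightarrow> i < length bs" if "even i" for i
    using assms that by presburger
  then have "{i. i < length (butlast bs) \<and> even i} = {i. i < length bs \<and> even i}" by auto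
  moreover have "lobe p (butlast bs) i = lobe p bs i" if "i < length bs" "even i" for i
  proof -
    have "Suc i < length bs" using that assms by presburger
    then show ?thesis by (simp add: lobe_def take_butlast)
  qed
  ultimately show ?thesis by (simp add: up_lobes_def)
qed

theorem vandermonde_up_lobes: "vandermonde (up_lobes p bs) = s bs * real (h (odd_sum bs))"
proof (cases "odd (length bs)")
  case True
  then show ?thesis by (simp add: s_def vandermonde_up_lobes_odd_length)
next
  case False
  show ?thesis
  proof (cases "bs = []")
    case True
    then show ?thesis by (simp add: up_lobes_def s_def s_odd_def odd_sum_def)
  next
    case nonempty: False
    have "odd_sum (butlast bs) = odd_sum bs"
      using False by (simp add: up_lobes_butlast flip: card_up_lobes[of 0])
    then show ?thesis
      using False nonempty vandermonde_up_lobes_odd_length[of "butlast bs" p]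
      by (simp add: s_def up_lobes_butlast)
  qed
qed

lemma dist_prod_up_lobes_interval:
  assumes len: "length bs = 2 * k" and "\<gamma> \<le> \<delta>" and "\<delta> \<le> p \<or> p + int (sum_list bs) \<le> \<gamma>"
  defines "c \<equiv> \<lambda>i. p + int (prefix_sum bs i)"
  shows "dist_prod (up_lobes p bs) {\<gamma>..<\<delta>}
     = (\<Prod>l<k. (h_dist (c (2 * l)) \<delta> / h_dist (c (2 * l)) \<gamma>)
         / (h_dist (c (2 * l + 1)) \<delta> / h_dist (c (2 * l + 1)) \<gamma>))"
proof -
  have "disjoint_family_on (\<lambda>l. lobe p bs (2 * l)) {..<k}"
    using disjoint_family_lobe[of p bs UNIV] by (auto simp: disjoint_family_on_def)
  then have "dist_prod (up_lobes p bs) {\<gamma>..<\<delta>} = (\<Prod>l<k. dist_prod (lobe p bs (2 * l)) {\<gamma>..<\<delta>})"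
    by (simp add: up_lobes_eq_UN_double len dist_prod_UN_left)
  also have "\<dots> = (\<Prod>l<k. (h_dist (c (2 * l)) \<delta> / h_dist (c (2 * l)) \<gamma>)
         / (h_dist (c (2 * l + 1)) \<delta> / h_dist (c (2 * l + 1)) \<gamma>))"
  proof (rule prod.cong [OF refl])
    fix l
    have "prefix_sum bs (2 * l) \<le> prefix_sum bs (2 * l + 1)" by (rule prefix_sum_mono) simp
    moreover have "prefix_sum bs (2 * l + 1) \<le> sum_list bs" by (rule prefix_sum_le)
    ultimately have "c (2 * l) \<le> c (2 * l + 1)" "c (2 * l + 1) \<le> \<gamma> \<or> \<delta> \<le> c (2 * l)"
      using assms(3) by (auto simp: c_def)
    then show "dist_prod (lobe p bs (2 * l)) {\<gamma>..<\<delta>}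
        = (h_dist (c (2 * l)) \<delta> / h_dist (c (2 * l)) \<gamma>)
         / (h_dist (c (2 * l + 1)) \<delta> / h_dist (c (2 * l + 1)) \<gamma>)"
      using dist_prod_intervals[of "c (2 * l)" "c (2 * l + 1)" \<gamma> \<delta>] assms(2)
      by (simp add: lobe_def c_def mult.commute)
  qed
  finally show ?thesis .
qed

section \<open>Fern-cored hexagons\<close>

lemma rotate_hexagon: "rotate_triangle (hexagon_centre2 X Y Z) ` hexagon X Y Z = hexagon X Y Z"
proof (rule rotate_triangle_image_eqI)
  fix t assume "t \<in> hexagon X Y Z"
  then show "rotate_triangle (hexagon_centre2 X Y Z) t \<in> hexagon X Y Z"
    by (cases t) (auto simp: mem_hexagon hexagon_centre2_def)
qed

lemma up_triangle_subset_trapezoid: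
  "0 \<le> p \<Longrightarrow> p + int b \<le> N \<Longrightarrow> b \<le> n \<Longrightarrow> up_triangle (p, j) b \<subseteq> trapezoid j N n"
proof
  fix t assume "0 \<le> p" "p + int b \<le> N" "b \<le> n" "t \<in> up_triangle (p, j) b"
  then show "t \<in> trapezoid j N n" by (cases t) (auto simp: mem_up_triangle mem_trapezoid)
qed

locale fern_cored_hexagon =
  fixes x y z a :: nat
  assumes even_sides: "even x" "even y" "even z"
begin

definition axis :: int where "axis = (int z - int y) div 2"
definition west :: int where "west = (int x + int y) div 2"
definition centre2 :: int where "centre2 = int x + int y + 2 * int a"
definition height :: nat where "height = (y + z) div 2 + a"
definition width :: int where "width = centre2 + axis"

lemma double_axis: "2 * axis = int z - int y"
  and double_west: "2 * west = int x + int y"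
  and double_height: "2 * int height = int y + int z + 2 * int a"
  using even_sides by (auto simp: axis_def west_def height_def elim!: evenE)

lemma west_eq: "west = int ((x + y) div 2)" and west_plus_axis: "west + axis = int ((x + z) div 2)"
  using even_sides by (auto simp: axis_def west_def elim!: evenE)

lemmas dimensions = double_axis double_west double_height

lemma centre2_eq: "centre2 = 2 * west + 2 * int a"
  using double_west by (simp add: centre2_def)

lemma width_eq: "width = int x + int a + int height"
  using dimensions by (simp add: width_def centre2_def)

definition base :: "int set" where
  "base = (if height = 0 then {} else {0..<width})"

definition fern_interval :: "int set" where
  "fern_interval = {west..<west + 2 * int a}"

text \<open>The upper half of the hexagon is a trapezoid with a triangle cut off at its right or left
  corner, depending on the sign of \<open>axis\<close>.\<close>

definition corner_triangle :: region where
  "corner_triangle = (if 0 \<le> axis then up_triangle (centre2, axis) (nat axis)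
     else up_triangle (0, axis) (nat (- axis)))"

definition corner_interval :: "int set" where
  "corner_interval = (if 0 \<le> axis then {centre2..<width} else {0..<- axis})"

definition symmetric_fern :: "nat list \<Rightarrow> bool" where
  "symmetric_fern bs \<longleftrightarrow> even (length bs) \<and> rev bs = bs \<and> sum_list bs = 2 * a"

definition dents :: "nat list \<Rightarrow> int set" where
  "dents bs = up_lobes west bs \<union> corner_interval"

lemma finite_intervals [simp]: "finite base" "finite fern_interval" "finite corner_interval"
  by (simp_all add: base_def fern_interval_def corner_interval_def)

lemma finite_dents [simp]: "finite (dents bs)"
  by (simp add: dents_def)

lemma symmetric_fernD:
  assumes "symmetric_fern bs"
  shows "even (length bs)" "rev bs = bs" "sum_list bs = 2 * a" "odd_sum bs = a"
  using assms odd_sum_palindrome[of bs] by (auto simp: symmetric_fern_def)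

lemma up_lobes_Un_mirror:
  assumes "symmetric_fern bs"
  shows "up_lobes west bs \<union> mirror centre2 ` up_lobes west bs = fern_interval"
    and "up_lobes west bs \<inter> mirror centre2 ` up_lobes west bs = {}"
  using mirror_up_lobes[of bs west] up_lobes_Un_down_lobes[of west bs]
    up_lobes_Int_down_lobes[of west bs] symmetric_fernD[OF assms]
  by (simp_all add: centre2_eq fern_interval_def)

lemma corner_Int_fern: "corner_interval \<inter> fern_interval = {}"
  using dimensions by (auto simp: corner_interval_def fern_interval_def centre2_def)

lemma up_lobes_Int_corner: "symmetric_fern bs \<Longrightarrow> up_lobes west bs \<inter> corner_interval = {}"
  using up_lobes_Un_mirror(1) corner_Int_fern by blast

lemma card_dents:
  assumes "symmetric_fern bs"
  shows "card (dents bs) = a + nat \<bar>axis\<bar>"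
proof -
  have "card (dents bs) = card (up_lobes west bs) + card corner_interval"
    unfolding dents_def using up_lobes_Int_corner[OF assms] by (simp add: card_Un_disjoint)
  then show ?thesis
    using symmetric_fernD(4)[OF assms] by (simp add: card_up_lobes corner_interval_def width_def)
qed

lemma dents_subset_base:
  assumes "symmetric_fern bs"
  shows "dents bs \<subseteq> base"
proof (cases "height = 0")
  case True
  then have "card (dents bs) = 0" using card_dents[OF assms] dimensions by simp
  then show ?thesis by simp
next
  case False
  have "dents bs \<subseteq> fern_interval \<union> corner_interval"
    using up_lobes_Un_mirror(1)[OF assms] by (auto simp: dents_def)
  also have "\<dots> \<subseteq> {0..<width}"
    using dimensions by (auto simp: fern_interval_def corner_interval_def width_def centre2_def)
  finally show ?thesis using False by (simp add: base_def)
qed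

lemma FC_eq:
  "symmetric_fern bs \<Longrightarrow> FC x y z bs = hexagon (x + a) (y + a) (z + a) - fern (west, axis) bs"
  by (simp add: FC_def symmetric_fernD(4) west_def axis_def Let_def)

lemma FC_centre2_eq: "symmetric_fern bs \<Longrightarrow> FC_centre2 x y z bs = (centre2, 2 * axis)"
  using double_axis
  by (simp add: FC_centre2_def hexagon_centre2_def symmetric_fernD(4) Let_def centre2_def)

lemma finite_FC: "symmetric_fern bs \<Longrightarrow> finite (FC x y z bs)"
  by (simp add: FC_eq finite_hexagon)

lemma rotate_FC:
  assumes "symmetric_fern bs"
  shows "rotate_triangle (centre2, 2 * axis) ` FC x y z bs = FC x y z bs"
proof -
  have "hexagon_centre2 (x + a) (y + a) (z + a) = (centre2, 2 * axis)"
    using double_axis by (simp add: hexagon_centre2_def centre2_def)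
  moreover have "rotate_triangle (centre2, 2 * axis) ` fern (west, axis) bs = fern (west, axis) bs"
    using rotate_fern[of bs west axis] symmetric_fernD[OF assms] by (simp add: centre2_eq)
  ultimately show ?thesis
    using rotate_hexagon[of "x + a" "y + a" "z + a"]
    by (simp add: FC_eq[OF assms] image_set_diff[OF inj_rotate_triangle])
qed

section \<open>The upper half of the hexagon\<close>

definition removed :: "nat list \<Rightarrow> region" where
  "removed bs = corner_triangle \<union> upper axis (fern (west, axis) bs)"

lemma standing_removed: "standing axis (removed bs)"
  unfolding removed_def corner_triangle_def
  by (intro standing_Un standing_upper_fern) (simp add: standing_up_triangle)

lemma Up_in_removed: "Up i axis \<in> removed bs \<longleftrightarrow> i \<in> dents bs"
  by (auto simp: removed_def dents_def Up_in_upper_fern corner_triangle_def corner_interval_def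
      mem_up_triangle width_def)

lemma upper_hexagon:
  "upper axis (hexagon (x + a) (y + a) (z + a)) = trapezoid axis width height - corner_triangle"
  using dimensions
  by (intro region_eqI)
    (auto simp: upper_def mem_hexagon mem_trapezoid corner_triangle_def mem_up_triangle
      width_def centre2_def)

lemma upper_FC:
  "symmetric_fern bs \<Longrightarrow> upper axis (FC x y z bs) = trapezoid axis width height - removed bs"
proof -
  assume "symmetric_fern bs"
  then have "upper axis (FC x y z bs)
      = upper axis (hexagon (x + a) (y + a) (z + a)) - upper axis (fern (west, axis) bs)"
    by (auto simp: FC_eq upper_def)
  then show ?thesis unfolding upper_hexagon removed_def by blast
qed

lemma removed_subset_trapezoid:
  assumes "symmetric_fern bs"
  shows "removed bs \<subseteq> trapezoid axis width height"
proof -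
  have "corner_triangle \<subseteq> trapezoid axis width height"
    using dimensions width_eq unfolding corner_triangle_def
    by (cases "0 \<le> axis") (simp_all add: up_triangle_subset_trapezoid width_def centre2_def)
  moreover have "up_triangle (west + int (prefix_sum bs i), axis) (bs ! i)
      \<subseteq> trapezoid axis width height"
    if i: "i < length bs" "even i" for i
  proof (rule up_triangle_subset_trapezoid)
    have "bs ! i \<le> odd_sum bs" unfolding odd_sum_def using i by (intro member_le_sum) auto
    then show "bs ! i \<le> height" using symmetric_fernD(4)[OF assms] by (simp add: height_def)
    have "prefix_sum bs (Suc i) \<le> sum_list bs" by (rule prefix_sum_le)
    then have "prefix_sum bs i + bs ! i \<le> 2 * a"
      using symmetric_fernD(3)[OF assms] i(1) by (simp add: prefix_sum_Suc)
    then show "west + int (prefix_sum bs i) + int (bs ! i) \<le> width"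
      using dimensions by (simp add: width_def centre2_def)
    show "0 \<le> west + int (prefix_sum bs i)" using double_west by simp
  qed
  ultimately show ?thesis unfolding removed_def upper_fern by blast
qed

definition free :: "int set" where
  "free = base \<inter> mirror centre2 ` base
     - (fern_interval \<union> corner_interval \<union> mirror centre2 ` corner_interval)"

lemma finite_free: "finite free"
  by (simp add: free_def)

lemma mirror_fern_interval: "mirror centre2 ` fern_interval = fern_interval"
  by (auto simp: set_eq_iff mem_mirror_image) (auto simp: mirror_def fern_interval_def centre2_eq)

lemma mirror_free: "mirror centre2 ` free = free"
  using mirror_fern_interval unfolding set_eq_iff mem_mirror_image
  by (simp add: free_def mem_mirror_image) blast

lemma free_Int_dents:
  assumes "symmetric_fern bs" "S \<subseteq> free"
  shows "S \<inter> dents bs = {}"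
  using assms(2) up_lobes_Un_mirror(1)[OF assms(1)] unfolding free_def dents_def by blast

lemma Up_axis_in_FC:
  assumes "symmetric_fern bs"
  shows "Up i axis \<in> FC x y z bs \<longleftrightarrow> i \<in> base - dents bs"
proof -
  have "Up i axis \<in> FC x y z bs \<longleftrightarrow> Up i axis \<in> upper axis (FC x y z bs)"
    by (simp add: upper_def)
  also have "\<dots> \<longleftrightarrow> i \<in> base - dents bs"
    by (auto simp: upper_FC[OF assms] Up_in_removed mem_trapezoid base_def)
  finally show ?thesis .
qed

lemma crossing_FC:
  assumes "symmetric_fern bs"
  shows "crossing axis (FC x y z bs) = free"
proof -
  have "Down i (axis - 1) \<in> FC x y z bs \<longleftrightarrow> Up (mirror centre2 i) axis \<in> FC x y z bs" for i
    using mem_rotate_triangle_image[of "Down i (axis - 1)" "(centre2, 2 * axis)" "FC x y z bs"]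
    by (simp add: rotate_FC[OF assms] mirror_def algebra_simps)
  then have "crossing axis (FC x y z bs) = (base - dents bs) \<inter> mirror centre2 ` (base - dents bs)"
    by (simp add: set_eq_iff crossing_def Up_axis_in_FC[OF assms] mem_mirror_image)
  also have "\<dots> = base \<inter> mirror centre2 ` base - (dents bs \<union> mirror centre2 ` dents bs)"
    unfolding image_set_diff[OF inj_mirror] by blast
  also have "dents bs \<union> mirror centre2 ` dents bs
      = fern_interval \<union> corner_interval \<union> mirror centre2 ` corner_interval"
    using up_lobes_Un_mirror(1)[OF assms] unfolding dents_def image_Un by blast
  finally show ?thesis by (simp only: free_def)
qed

definition crossing_sets :: "int set set" where
  "crossing_sets = {S. S \<subseteq> free \<and> card S + (a + nat \<bar>axis\<bar>) = height}"

lemma finite_crossing_sets: "finite crossing_sets"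
  unfolding crossing_sets_def using finite_free by simp

lemma mirror_crossing_sets: "mirror centre2 ` S \<in> crossing_sets \<longleftrightarrow> S \<in> crossing_sets"
proof -
  have "mirror centre2 ` S \<subseteq> free \<longleftrightarrow> S \<subseteq> free"
    using mirror_free by (metis image_mono mirror_image_image)
  then show ?thesis by (simp add: crossing_sets_def card_image inj_mirror)
qed

lemma M_upper_FC:
  assumes bs: "symmetric_fern bs" and S: "S \<subseteq> free"
  shows "real (M (upper axis (FC x y z bs) - ups axis S))
    = (if S \<in> crossing_sets then vandermonde (S \<union> dents bs) / real (h height) else 0)"
proof -
  let ?trapezoid = "trapezoid axis width height"
  have "removed bs \<subseteq> ?trapezoid - ups axis S"
    using removed_subset_trapezoid[OF bs] Up_in_removed[of _ bs] free_Int_dents[OF bs S]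
    by (auto simp: ups_def)
  then have "M (?trapezoid - ups axis S - removed bs)
      = M (?trapezoid - ups axis S - ups axis (dents bs))"
    using M_Diff_standing[OF standing_removed] by (simp add: Up_in_removed)
  also have "?trapezoid - ups axis S - removed bs = upper axis (FC x y z bs) - ups axis S"
    unfolding upper_FC[OF bs] by blast
  also have "?trapezoid - ups axis S - ups axis (dents bs) = ?trapezoid - ups axis (S \<union> dents bs)"
    by (auto simp: ups_def)
  finally have "M (upper axis (FC x y z bs) - ups axis S)
      = M (?trapezoid - ups axis (S \<union> dents bs))" .
  moreover have "S \<union> dents bs \<subseteq> base"
    using dents_subset_base[OF bs] S by (auto simp: free_def)
  moreover have "card (S \<union> dents bs) = card S + (a + nat \<bar>axis\<bar>)"
    using free_Int_dents[OF bs S] finite_subset[OF S finite_free]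
    by (simp add: card_Un_disjoint card_dents[OF bs])
  ultimately show ?thesis
    using M_trapezoid[of "S \<union> dents bs" height width axis] width_eq S
    by (simp add: crossing_sets_def base_def)
qed

section \<open>Counting all and all centrally symmetric tilings\<close>

definition weight :: "int set \<Rightarrow> real" where
  "weight S = dist_prod S fern_interval * dist_prod S corner_interval
     * dist_prod S (mirror centre2 ` corner_interval)"

lemma weight_pos: "S \<subseteq> free \<Longrightarrow> 0 < weight S"
  unfolding weight_def by (intro mult_pos_pos dist_prod_pos) (auto simp: free_def)

lemma dist_prod_dents:
  assumes bs: "symmetric_fern bs"
  shows "dist_prod S (dents bs) * dist_prod S (mirror centre2 ` dents bs) = weight S"
proof -
  let ?U = "up_lobes west bs" and ?\<mu> = "mirror centre2"
  have "dist_prod S (dents bs) = dist_prod S ?U * dist_prod S corner_interval"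
    unfolding dents_def using up_lobes_Int_corner[OF bs] by (simp add: dist_prod_Un_right)
  moreover have "?\<mu> ` ?U \<inter> ?\<mu> ` corner_interval = {}"
    using up_lobes_Int_corner[OF bs] by (simp flip: image_Int[OF inj_mirror])
  then have "dist_prod S (?\<mu> ` dents bs)
      = dist_prod S (?\<mu> ` ?U) * dist_prod S (?\<mu> ` corner_interval)"
    unfolding dents_def image_Un by (simp add: dist_prod_Un_right)
  moreover have "dist_prod S fern_interval = dist_prod S ?U * dist_prod S (?\<mu> ` ?U)"
    using up_lobes_Un_mirror(2)[OF bs]
    by (simp add: dist_prod_Un_right flip: up_lobes_Un_mirror(1)[OF bs])
  ultimately show ?thesis by (simp add: weight_def)
qed

lemma vandermonde_dents_mirror:
  assumes bs: "symmetric_fern bs" and S: "S \<subseteq> free"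
  shows "vandermonde (S \<union> dents bs) * vandermonde (mirror centre2 ` S \<union> dents bs)
       = (vandermonde (dents bs))\<^sup>2 * ((vandermonde S)\<^sup>2 * weight S)"
proof -
  have "finite S" using S finite_free by (rule finite_subset)
  moreover have "mirror centre2 ` S \<inter> dents bs = {}"
    using free_Int_dents[OF bs, of "mirror centre2 ` S"] mirror_free S by blast
  ultimately show ?thesis
    using free_Int_dents[OF bs S]
    by (simp add: vandermonde_Un vandermonde_mirror dist_prod_mirror power2_eq_square
        mult_ac flip: dist_prod_dents[OF bs])
qed

lemma vandermonde_dents_symmetric:
  assumes bs: "symmetric_fern bs" and S: "S \<subseteq> free" "mirror centre2 ` S = S"
  shows "vandermonde (S \<union> dents bs) = vandermonde (dents bs) * (vandermonde S * sqrt (weight S))"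
proof -
  have "vandermonde (S \<union> dents bs) = sqrt (vandermonde (S \<union> dents bs) * vandermonde (S \<union> dents bs))"
    by (simp add: abs_of_pos vandermonde_pos)
  also have "\<dots> = sqrt ((vandermonde (dents bs))\<^sup>2 * ((vandermonde S)\<^sup>2 * weight S))"
    using vandermonde_dents_mirror[OF bs S(1)] S(2) by simp
  finally show ?thesis
    by (simp add: real_sqrt_mult abs_of_pos vandermonde_pos)
qed

definition crossing_sum :: real where
  "crossing_sum = (\<Sum>S\<in>crossing_sets. (vandermonde S)\<^sup>2 * weight S / (real (h height))\<^sup>2)"

definition symmetric_crossing_sum :: real where
  "symmetric_crossing_sum
     = (\<Sum>S | S \<in> crossing_sets \<and> mirror centre2 ` S = S.
         vandermonde S * sqrt (weight S) / real (h height))"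

theorem M_FC:
  assumes bs: "symmetric_fern bs"
  shows "real (M (FC x y z bs)) = (vandermonde (dents bs))\<^sup>2 * crossing_sum"
proof -
  let ?M = "\<lambda>S. real (M (upper axis (FC x y z bs) - ups axis S))"
  have "real (M (FC x y z bs)) = (\<Sum>S\<in>Pow free. ?M S * ?M (mirror centre2 ` S))"
    using M_cut_row_symmetric[OF finite_FC[OF bs] rotate_FC[OF bs]]
    by (simp add: crossing_FC[OF bs])
  also have "\<dots> = (\<Sum>S\<in>crossing_sets.
      (vandermonde (dents bs))\<^sup>2 * ((vandermonde S)\<^sup>2 * weight S / (real (h height))\<^sup>2))"
  proof (rule sum.mono_neutral_cong_right)
    show "crossing_sets \<subseteq> Pow free" by (auto simp: crossing_sets_def)
    show "\<forall>S\<in>Pow free - crossing_sets. ?M S * ?M (mirror centre2 ` S) = 0"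
      by (simp add: M_upper_FC[OF bs])
    fix S assume S: "S \<in> crossing_sets"
    then have "S \<subseteq> free" "mirror centre2 ` S \<subseteq> free" "mirror centre2 ` S \<in> crossing_sets"
      using mirror_crossing_sets[of S] by (auto simp: crossing_sets_def)
    then show "?M S * ?M (mirror centre2 ` S)
        = (vandermonde (dents bs))\<^sup>2 * ((vandermonde S)\<^sup>2 * weight S / (real (h height))\<^sup>2)"
      using S vandermonde_dents_mirror[OF bs] by (simp add: M_upper_FC[OF bs] power2_eq_square)
  qed (simp add: finite_free)
  finally show ?thesis by (simp add: crossing_sum_def sum_distrib_left)
qed

theorem M_odot_FC:
  assumes bs: "symmetric_fern bs"
  shows "real (M_odot (FC_centre2 x y z bs) (FC x y z bs))
    = vandermonde (dents bs) * symmetric_crossing_sum"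
proof -
  have "real (M_odot (FC_centre2 x y z bs) (FC x y z bs)) = (\<Sum>S | S \<subseteq> free \<and> mirror centre2 ` S = S.
      real (M (upper axis (FC x y z bs) - ups axis S)))"
    using M_odot_cut_row[OF finite_FC[OF bs] rotate_FC[OF bs]]
    by (simp add: crossing_FC[OF bs] FC_centre2_eq[OF bs])
  also have "\<dots> = (\<Sum>S | S \<in> crossing_sets \<and> mirror centre2 ` S = S.
      vandermonde (dents bs) * (vandermonde S * sqrt (weight S) / real (h height)))"
    using finite_free
    by (intro sum.mono_neutral_cong_right)
      (auto simp: M_upper_FC[OF bs] vandermonde_dents_symmetric[OF bs] crossing_sets_def)
  finally show ?thesis by (simp add: symmetric_crossing_sum_def sum_distrib_left)
qed

lemma ex_symmetric_crossing_set: "\<exists>S\<in>crossing_sets. mirror centre2 ` S = S"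
proof -
  define t where "t = int (min y z) div 2"
  have t: "2 * t = int (min y z)" using even_sides by (auto simp: t_def min_def)
  define S where "S = {west - t..<west} \<union> {west + 2 * int a..<west + 2 * int a + t}"
  have "card S = nat t + nat t"
    unfolding S_def by (subst card_Un_disjoint) (use t in auto)
  then have card: "card S + (a + nat \<bar>axis\<bar>) = height"
    using t dimensions by (auto simp: min_def split: if_splits)
  have mirror: "mirror centre2 ` S = S"
    by (auto simp: set_eq_iff mem_mirror_image) (auto simp: S_def mirror_def centre2_eq)
  have "S \<subseteq> base - (fern_interval \<union> corner_interval)"
  proof
    fix i assume i: "i \<in> S"
    then have "height \<noteq> 0" using t double_height by (auto simp: S_def)
    then show "i \<in> base - (fern_interval \<union> corner_interval)"
      using i t dimensions
      by (auto simp: S_def base_def fern_interval_def corner_interval_def min_def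
          width_def centre2_def split: if_splits)
  qed
  moreover from this
  have "mirror centre2 ` S \<subseteq> mirror centre2 ` (base - (fern_interval \<union> corner_interval))"
    by (rule image_mono)
  ultimately have "S \<subseteq> free" unfolding mirror free_def image_set_diff[OF inj_mirror] by blast
  then show ?thesis using card mirror by (auto simp: crossing_sets_def)
qed

lemma crossing_sum_pos: "0 < crossing_sum"
proof -
  obtain S where "S \<in> crossing_sets" using ex_symmetric_crossing_set by blast
  moreover have "0 < (vandermonde S)\<^sup>2 * weight S / (real (h height))\<^sup>2"
    if "S \<in> crossing_sets" for S
    using that weight_pos[of S] vandermonde_pos[of S] by (simp add: crossing_sets_def h_pos)
  ultimately show ?thesis
    unfolding crossing_sum_def using finite_crossing_sets by (intro sum_pos) auto
qed

lemma symmetric_crossing_sum_pos: "0 < symmetric_crossing_sum"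
proof -
  obtain S where "S \<in> crossing_sets" "mirror centre2 ` S = S"
    using ex_symmetric_crossing_set by blast
  moreover have "0 < vandermonde S * sqrt (weight S) / real (h height)" if "S \<in> crossing_sets" for S
    using that weight_pos[of S] vandermonde_pos[of S] by (simp add: crossing_sets_def h_pos)
  ultimately show ?thesis
    unfolding symmetric_crossing_sum_def using finite_crossing_sets by (intro sum_pos) auto
qed

theorem
  assumes "symmetric_fern bs" "symmetric_fern bs'"
  shows M_odot_FC_ratio:
      "real (M_odot (FC_centre2 x y z bs) (FC x y z bs))
         / real (M_odot (FC_centre2 x y z bs') (FC x y z bs'))
       = vandermonde (dents bs) / vandermonde (dents bs')"
    and sqrt_M_FC_ratio:
      "sqrt (real (M (FC x y z bs)) / real (M (FC x y z bs')))
       = vandermonde (dents bs) / vandermonde (dents bs')"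
  using symmetric_crossing_sum_pos crossing_sum_pos
    vandermonde_pos[of "dents bs"] vandermonde_pos[of "dents bs'"]
  by (simp_all add: M_odot_FC M_FC assms real_sqrt_divide)

section \<open>The product formula\<close>

definition h_xy :: "nat \<Rightarrow> real" where "h_xy m = real (h ((x + y) div 2 + m))"
definition h_xz :: "nat \<Rightarrow> real" where "h_xz m = real (h ((x + z) div 2 + m))"

lemma h_xy_neq_0 [simp]: "h_xy m \<noteq> 0" and h_xz_neq_0 [simp]: "h_xz m \<noteq> 0"
  by (simp_all add: h_xy_def h_xz_def)

definition h_ratio :: "nat \<Rightarrow> real" where "h_ratio m = h_xy m / h_xz m"

lemma h_ratio_neq_0 [simp]: "h_ratio m \<noteq> 0"
  by (simp add: h_ratio_def)

lemma dist_prod_up_lobes_left_corner: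
  assumes len: "length bs = 2 * k" and "axis < 0"
  defines "r \<equiv> \<lambda>i. h_ratio (prefix_sum bs i)"
  shows "dist_prod (up_lobes west bs) corner_interval = (\<Prod>l<k. r (2 * l + 1) / r (2 * l))"
proof -
  have "h_dist (west + int m) 0 = h_xy m" for m
    by (simp add: h_dist_def h_xy_def west_eq nat_int_add)
  moreover have "h_dist (west + int m) (- axis) = h_xz m" for m
  proof -
    have "\<bar>west + int m - - axis\<bar> = int ((x + z) div 2 + m)" using west_plus_axis by simp
    then show ?thesis by (simp only: h_dist_def h_xz_def nat_int)
  qed
  moreover have "0 \<le> - axis" "- axis \<le> west" using west_plus_axis \<open>axis < 0\<close> by simp_all
  ultimately show ?thesis
    using dist_prod_up_lobes_interval[OF len, of 0 "- axis" west] \<open>axis < 0\<close>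
    by (simp add: corner_interval_def r_def h_ratio_def mult.commute)
qed

lemma dist_prod_up_lobes_right_corner:
  assumes len: "length bs = 2 * k" and bs: "symmetric_fern bs" and "0 \<le> axis"
  defines "r \<equiv> \<lambda>i. h_ratio (prefix_sum bs i)"
  shows "dist_prod (up_lobes west bs) corner_interval = (\<Prod>l<k. r (2 * l + 1) / r (2 * l + 2))"
proof -
  define c where "c i = west + int (prefix_sum bs i)" for i
  have reflect: "h_dist (c i) centre2 = h_xy (prefix_sum bs (2 * k - i))"
    "h_dist (c i) width = h_xz (prefix_sum bs (2 * k - i))" for i
  proof -
    have "int (prefix_sum bs (2 * k - i)) + int (prefix_sum bs i) = 2 * int a"
      using prefix_sum_palindrome[of bs i] symmetric_fernD(2,3)[OF bs] len by simp
    then have "\<bar>c i - centre2\<bar> = int ((x + y) div 2 + prefix_sum bs (2 * k - i))"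
      "\<bar>c i - width\<bar> = int ((x + z) div 2 + prefix_sum bs (2 * k - i))"
      using west_eq west_plus_axis by (simp_all add: c_def width_def centre2_eq)
    then show "h_dist (c i) centre2 = h_xy (prefix_sum bs (2 * k - i))"
      "h_dist (c i) width = h_xz (prefix_sum bs (2 * k - i))"
      by (simp_all only: h_dist_def h_xy_def h_xz_def nat_int)
  qed
  have "dist_prod (up_lobes west bs) corner_interval
      = (\<Prod>l<k. (h_dist (c (2 * l)) width / h_dist (c (2 * l)) centre2)
          / (h_dist (c (2 * l + 1)) width / h_dist (c (2 * l + 1)) centre2))"
    using dist_prod_up_lobes_interval[OF len, of centre2 width west] \<open>0 \<le> axis\<close>
      symmetric_fernD(3)[OF bs] west_eq
    by (simp add: corner_interval_def c_def width_def centre2_eq)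
  also have "\<dots> = (\<Prod>l<k. r (2 * (k - Suc l) + 1) / r (2 * (k - Suc l) + 2))"
  proof (rule prod.cong [OF refl])
    fix l assume "l \<in> {..<k}"
    then have "2 * k - 2 * l = 2 * (k - Suc l) + 2"
      "2 * k - (2 * l + 1) = 2 * (k - Suc l) + 1" by auto
    then show "(h_dist (c (2 * l)) width / h_dist (c (2 * l)) centre2)
          / (h_dist (c (2 * l + 1)) width / h_dist (c (2 * l + 1)) centre2)
        = r (2 * (k - Suc l) + 1) / r (2 * (k - Suc l) + 2)"
      unfolding reflect by (simp add: r_def h_ratio_def mult.commute)
  qed
  also have "\<dots> = (\<Prod>l<k. r (2 * l + 1) / r (2 * l + 2))"
    by (rule prod.nat_diff_reindex)
  finally show ?thesis .
qed

definition corner_factor :: real where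
  "corner_factor = h_ratio (if 0 \<le> axis then 2 * a else 0)"

lemma corner_factor_neq_0 [simp]: "corner_factor \<noteq> 0"
  by (simp add: corner_factor_def)

lemma dist_prod_up_lobes_corner:
  assumes len: "length bs = 2 * k" "0 < k" and bs: "symmetric_fern bs"
  defines "r \<equiv> \<lambda>i. h_ratio (prefix_sum bs i)"
  shows "corner_factor * dist_prod (up_lobes west bs) corner_interval
    = (\<Prod>l<k. r (2 * l + 1)) / (\<Prod>l\<in>{1..<k}. r (2 * l))"
proof (cases "0 \<le> axis")
  case True
  have "(\<Prod>l<k. r (2 * l + 2)) = (\<Prod>l\<in>{1..<Suc k}. r (2 * l))"
    by (rule prod.reindex_bij_witness[where i = "\<lambda>l. l - 1" and j = Suc]) auto
  also have "\<dots> = (\<Prod>l\<in>{1..<k}. r (2 * l)) * corner_factor"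
    using True len symmetric_fernD(3)[OF bs] by (simp add: corner_factor_def r_def)
  finally show ?thesis
    using dist_prod_up_lobes_right_corner[OF len(1) bs True] by (simp add: r_def prod_dividef)
next
  case False
  have "(\<Prod>l<k. r (2 * l)) = (\<Prod>l\<in>{1..<k}. r (2 * l)) * corner_factor"
    using len(2) False
    by (simp add: lessThan_atLeast0 prod.atLeast_Suc_lessThan corner_factor_def r_def)
  then show ?thesis
    using dist_prod_up_lobes_left_corner[OF len(1)] False by (simp add: r_def prod_dividef)
qed

lemma vandermonde_dents:
  assumes "symmetric_fern bs"
  shows "vandermonde (dents bs)
    = s bs * real (h a) * vandermonde corner_interval
      * dist_prod (up_lobes west bs) corner_interval"
  using up_lobes_Int_corner[OF assms] symmetric_fernD(4)[OF assms]
  by (simp add: dents_def vandermonde_Un vandermonde_up_lobes)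

theorem vandermonde_dents_ratio:
  assumes len: "length bs = 2 * k" "0 < k" and bs: "symmetric_fern bs"
  shows "vandermonde (dents bs) / vandermonde (dents [a, a])
    = s bs * (h_xz a / h_xy a)
      * (\<Prod>l<k. h_xy (prefix_sum bs (2 * l + 1)) / h_xz (prefix_sum bs (2 * l + 1)))
      * (\<Prod>l\<in>{1..<k}. h_xz (prefix_sum bs (2 * l)) / h_xy (prefix_sum bs (2 * l)))"
proof -
  let ?dist = "\<lambda>bs. dist_prod (up_lobes west bs) corner_interval"
  have aa: "symmetric_fern [a, a]" by (simp add: symmetric_fern_def)
  have "s [a, a] = 1"
    using vandermonde_up_lobes[of 0 "[a, a]"] symmetric_fernD(4)[OF aa]
    by (simp add: up_lobes_eq_UN_double lobe_def vandermonde_atLeastLessThan lessThan_Suc)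
  then have "vandermonde (dents bs) / vandermonde (dents [a, a])
      = s bs * ((corner_factor * ?dist bs) / (corner_factor * ?dist [a, a]))"
    using vandermonde_pos[of corner_interval] by (simp add: vandermonde_dents bs aa)
  also have "corner_factor * ?dist [a, a] = h_ratio a"
    using dist_prod_up_lobes_corner[of "[a, a]" 1] aa by (simp add: lessThan_Suc)
  finally show ?thesis
    by (simp add: dist_prod_up_lobes_corner[OF len bs] h_ratio_def prod_dividef mult_ac)
qed

end

theorem theorem2p1:
  fixes x y z k a :: nat and as bs :: "nat list"
  assumes "even x" and "even y" and "even z"
    and "k \<ge> 1" and "length as = k"
    and "bs = as @ rev as"
    and "a = sum_list as"
  shows "real (M_odot (FC_centre2 x y z bs) (FC x y z bs))
           / real (M_odot (FC_centre2 x y z [a, a]) (FC x y z [a, a]))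
         = sqrt (real (M (FC x y z bs)) / real (M (FC x y z [a, a])))
       \<and> sqrt (real (M (FC x y z bs)) / real (M (FC x y z [a, a])))
         = s bs * (real (h ((x + z) div 2 + a)) / real (h ((x + y) div 2 + a)))
           * (\<Prod>i | 1 \<le> 2 * i + 1 \<and> 2 * i + 1 \<le> 2 * k.
                real (h ((x + y) div 2 + sum_list (take (2 * i + 1) bs)))
                / real (h ((x + z) div 2 + sum_list (take (2 * i + 1) bs))))
           * (\<Prod>i | 1 < 2 * i \<and> 2 * i < 2 * k.
                real (h ((x + z) div 2 + sum_list (take (2 * i) bs)))
                / real (h ((x + y) div 2 + sum_list (take (2 * i) bs))))"
proof -
  interpret fern_cored_hexagon x y z a
    using assms by unfold_locales auto
  have ferns: "symmetric_fern bs" "symmetric_fern [a, a]"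
    unfolding symmetric_fern_def using assms(6,7) by simp_all
  have len: "length bs = 2 * k" "0 < k" using assms by auto
  have "{i. 1 \<le> 2 * i + 1 \<and> 2 * i + 1 \<le> 2 * k} = {..<k}" "{i. 1 < 2 * i \<and> 2 * i < 2 * k} = {1..<k}"
    by auto
  then show ?thesis
    using M_odot_FC_ratio[OF ferns] sqrt_M_FC_ratio[OF ferns]
      vandermonde_dents_ratio[OF len ferns(1)]
    by (simp only: h_xy_def h_xz_def)
qed

end
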